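(* Let $m/n\in(0,1/2)$ with $m>1$, and $1\le i<\alpha$. There is a bijection from $(0,1)\cap\mathbb Q$ to $TT(m/n,k_i,B)$ sending $p/q$ (lowest terms) to the orbit $P_{i,p/q,m/n}$ whose data $((N_r),\pi,(A,B,C))$ is: $A=\{p\}$, $B=\{0,\dots,q-1\}\setminus\{p\}$, $C=\{q\}$; $N_r=1$ for $r\in R$, $N_r=q+1-p$ for $r\in S$, $N_r=q+1$ for $r\in T$; and $\pi(0,s)=(k_i,q-p+s)$ for $0\le s<p$, $\pi(0,p)=(k_{i+1},q-p)$, $\pi(0,s)=(k_{i+1},s-p)$ for $p+1\le s<q$, $\pi(0,q)=(m,0)$; $\pi(k_i+n-m,q-p)=(k_i,q)$; and $\pi(r,s)=(r+_nm,s)$ for all other $(r,s)$.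
   Context: Rationals in lowest terms; $\mathrm{LFS}(m/n)=(0=u_1/v_1,\dots,u_\alpha/v_\alpha)$ is the left Farey sequence ($u_\alpha/v_\alpha$ the left Farey parent of $m/n$, each term the left Farey parent of the next). $+_n$ is addition mod $n$; $\mathcal O_{m/n}[r,s]$ is the segment $r,r+_nm,r+_n2m,\dots,s$ of the orbit of $r$ under addition of $m$ mod $n$. $\mathcal A_{m/n}=\{k\in[0,m-1]\colon\{k+1,\dots,m-1\}\cap\mathcal O_{m/n}[k,0]=\emptyset\}$, with elements $0=k_1<\cdots<k_\alpha=m-1$. For $i<\alpha$: $R=\mathcal O_{m/n}[m,k_{i+1}+n-m]$, $S=\mathcal O_{m/n}[k_{i+1},k_i+n-m]$, $T=\mathcal O_{m/n}[k_i,0]$ (a partition of $\mathbb Z_n$). Star setting: $\Gamma_n$ an $n$-star with edges $e_0,\dots,e_{n-1}$ and central vertex $v$; $f_{m/n}(e_0)=e_0\bar e_1e_1\cdots\bar e_me_m$, $f_{m/n}(e_r)=e_{r+_nm}$ ($r\ne0$). A $\ast$-orbit is a periodic orbit $P\ne\{v\}$ meeting every edge with $f(P\cap e_0)\not\subseteq e_m$ and $f(p_r)=p_{r+_nm}$ for $r\ne0$ ($p_r$ nearest point of $P\cap e_r$ to the initial point). Data $((N_r),\pi,(A,B,C))$: $N_r=\#(P\cap e_r)$; points labelled $(r,0),\dots,(r,N_r-1)$ from the initial point; $\pi=f|_P$; $s\in A,B,C$ according as the truncated map ($f$ followed by retraction onto the span of $P$) is locally orientation-reversing, orientation-preserving,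 or non-injective at $(0,s)$. Orbits with equal data are identified. $\mathcal P(m/n,k,\gamma)$: $\ast$-orbits with $\pi(0,0)\in e_k$, $0\in\gamma$. $TT(m/n,k,\gamma)$: those satisfying, with $\pi_j=\tau_j\circ\pi$ ($\tau_j$ coordinate projections) and $\alpha\cup\beta$ the partition of $\mathcal L\setminus\{(r,0)\}$ given by $\pi^{-1}(m,0)\in\beta$ and $\pi^{-i}(m,0),\pi^{-i+1}(m,0)$ ($2\le i\le\#P-n$) in different sets iff $\tau_1(\pi^{-i}(m,0))=0$ and $\tau_2(\pi^{-i}(m,0))\in A$: (a) for $s<N_0-1$, $\pi(0,s)\in\alpha$ if $s\in B$, $\in\beta$ if $s\in A$; (b) $N_{r+n-m}=1$ for $k<r<m$; (c) if $s>0$ and $\pi_2(k+n-m,s)>\pi_2(0,0)$ then $\pi(k+n-m,s)\in\beta$; (d) if $\gamma=A$ then $\pi_2(k+n-m,s)>\pi_2(0,0)$ for all $s>0$. *)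

theory Defs
  imports Complex_Main
begin

text \<open>Points of the n-star: the central vertex Ctr, and Ed r t, the point on edge e_r
 at parameter t in [0,1), where t = 0 is the initial (outer) point of e_r and t -> 1
 approaches the central vertex v.\<close>

datatype spt = Ctr | Ed nat real

definition valid_pt :: "nat \<Rightarrow> spt \<Rightarrow> bool" where
  "valid_pt n x = (case x of Ctr \<Rightarrow> True | Ed r t \<Rightarrow> r < n \<and> 0 \<le> t \<and> t < 1)"

definition on_edge :: "nat \<Rightarrow> spt \<Rightarrow> bool" where
  "on_edge r y = (\<exists>t. y = Ed r t)"

definition epar :: "spt \<Rightarrow> real" where
  "epar y = (case y of Ctr \<Rightarrow> 1 | Ed r t \<Rightarrow> t)"

text \<open>Piecewise-linear realisation of f_{m/n}: e_0 is divided into 2m+1 equal pieces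
 mapped linearly onto e_0, \bar e_1, e_1, ..., \bar e_m, e_m; e_r maps isometrically to
 e_{r +_n m} for r \<noteq> 0; v is fixed.\<close>

definition fstar :: "nat \<Rightarrow> nat \<Rightarrow> spt \<Rightarrow> spt" where
  "fstar n m x = (case x of Ctr \<Rightarrow> Ctr
     | Ed r t \<Rightarrow>
        (if r = 0 then
           (let u = (2 * real m + 1) * t; j = nat \<lfloor>u\<rfloor>; w = u - real j in
             if j = 0 then Ed 0 u
             else if odd j then (if w = 0 then Ctr else Ed ((j + 1) div 2) (1 - w))
             else Ed (j div 2) w)
         else Ed ((r + m) mod n) t))"

definition edge_pts :: "spt set \<Rightarrow> nat \<Rightarrow> real set" where
  "edge_pts P r = {t. Ed r t \<in> P}"

definition Ncnt :: "spt set \<Rightarrow> nat \<Rightarrow> nat" where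
  "Ncnt P r = card (edge_pts P r)"

definition ptlab :: "spt set \<Rightarrow> nat \<Rightarrow> nat \<Rightarrow> spt" where
  "ptlab P r j = Ed r (sorted_list_of_set (edge_pts P r) ! j)"

definition lab :: "spt set \<Rightarrow> spt \<Rightarrow> nat \<times> nat" where
  "lab P y = (case y of Ctr \<Rightarrow> undefined
               | Ed r t \<Rightarrow> (r, card {t'\<in>edge_pts P r. t' < t}))"

definition labels :: "nat list \<Rightarrow> (nat \<times> nat) set" where
  "labels N = {(r, s). r < length N \<and> s < N ! r}"

definition Nlist :: "nat \<Rightarrow> spt set \<Rightarrow> nat list" where
  "Nlist n P = map (Ncnt P) [0..<n]"

definition piP :: "nat \<Rightarrow> nat \<Rightarrow> spt set \<Rightarrow> nat \<times> nat \<Rightarrow> nat \<times> nat" where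
  "piP n m P = (\<lambda>l. if l \<in> labels (Nlist n P)
                     then lab P (fstar n m (ptlab P (fst l) (snd l))) else undefined)"

text \<open>Retraction of the star onto the span of P, and the truncated map.\<close>
definition retr :: "spt set \<Rightarrow> spt \<Rightarrow> spt" where
  "retr P y = (case y of Ctr \<Rightarrow> Ctr
     | Ed r t \<Rightarrow> (if edge_pts P r \<noteq> {} \<and> t < Min (edge_pts P r)
                  then Ed r (Min (edge_pts P r)) else Ed r t))"

definition trunc :: "nat \<Rightarrow> nat \<Rightarrow> spt set \<Rightarrow> spt \<Rightarrow> spt" where
  "trunc n m P = retr P \<circ> fstar n m"

text \<open>Neighbourhood of parameter t0 in (span P) \<inter> e_0.\<close>
definition nbhd0 :: "spt set \<Rightarrow> real \<Rightarrow> real \<Rightarrow> real set" where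
  "nbhd0 P t0 e = {t. Min (edge_pts P 0) \<le> t \<and> t < 1 \<and> \<bar>t - t0\<bar> < e}"

definition loc_rev :: "nat \<Rightarrow> nat \<Rightarrow> spt set \<Rightarrow> real \<Rightarrow> bool" where
  "loc_rev n m P t0 = (\<exists>e>0. \<exists>r. (\<forall>t\<in>nbhd0 P t0 e. on_edge r (trunc n m P (Ed 0 t))) \<and>
      (\<forall>t1\<in>nbhd0 P t0 e. \<forall>t2\<in>nbhd0 P t0 e. t1 < t2 \<longrightarrow>
          epar (trunc n m P (Ed 0 t2)) < epar (trunc n m P (Ed 0 t1))))"

definition loc_pres :: "nat \<Rightarrow> nat \<Rightarrow> spt set \<Rightarrow> real \<Rightarrow> bool" where
  "loc_pres n m P t0 = (\<exists>e>0. \<exists>r. (\<forall>t\<in>nbhd0 P t0 e. on_edge r (trunc n m P (Ed 0 t))) \<and>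
      (\<forall>t1\<in>nbhd0 P t0 e. \<forall>t2\<in>nbhd0 P t0 e. t1 < t2 \<longrightarrow>
          epar (trunc n m P (Ed 0 t1)) < epar (trunc n m P (Ed 0 t2))))"

definition loc_noninj :: "nat \<Rightarrow> nat \<Rightarrow> spt set \<Rightarrow> real \<Rightarrow> bool" where
  "loc_noninj n m P t0 = (\<forall>e>0. \<not> inj_on (\<lambda>t. trunc n m P (Ed 0 t)) (nbhd0 P t0 e))"

definition labpar :: "spt set \<Rightarrow> nat \<Rightarrow> nat \<Rightarrow> real" where
  "labpar P r s = sorted_list_of_set (edge_pts P r) ! s"

type_synonym odata = "nat list \<times> (nat \<times> nat \<Rightarrow> nat \<times> nat) \<times> nat set \<times> nat set \<times> nat set"

definition odata :: "nat \<Rightarrow> nat \<Rightarrow> spt set \<Rightarrow> odata" where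
  "odata n m P = (Nlist n P, piP n m P,
      {s. s < Ncnt P 0 \<and> loc_rev n m P (labpar P 0 s)},
      {s. s < Ncnt P 0 \<and> loc_pres n m P (labpar P 0 s)},
      {s. s < Ncnt P 0 \<and> loc_noninj n m P (labpar P 0 s)})"

definition star_orbit :: "nat \<Rightarrow> nat \<Rightarrow> spt set \<Rightarrow> bool" where
  "star_orbit n m P =
    ((\<exists>x k. valid_pt n x \<and> 0 < k \<and> (fstar n m ^^ k) x = x \<and>
            P = {(fstar n m ^^ j) x | j. j < k}) \<and>
     P \<noteq> {Ctr} \<and>
     (\<forall>r<n. edge_pts P r \<noteq> {}) \<and>
     \<not> (fstar n m ` {y\<in>P. on_edge 0 y} \<subseteq> {y. on_edge m y}) \<and>
     (\<forall>r. 0 < r \<and> r < n \<longrightarrow> fstar n m (ptlab P r 0) = ptlab P ((r + m) mod n) 0))"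

datatype abc = GA | GB | GC

fun gsel :: "abc \<Rightarrow> odata \<Rightarrow> nat set" where
  "gsel GA (N, pm, A, B, C) = A"
| "gsel GB (N, pm, A, B, C) = B"
| "gsel GC (N, pm, A, B, C) = C"

definition Pcond :: "nat \<Rightarrow> abc \<Rightarrow> odata \<Rightarrow> bool" where
  "Pcond k g D = (case D of (N, pm, A, B, C) \<Rightarrow> fst (pm (0, 0)) = k \<and> 0 \<in> gsel g D)"

definition prei :: "nat \<Rightarrow> odata \<Rightarrow> nat \<Rightarrow> nat \<times> nat" where
  "prei m D i = (case D of (N, pm, A, B, C) \<Rightarrow> (inv_into (labels N) pm ^^ i) (m, 0))"

text \<open>col m D i = True iff pm^{-i}(m,0) is placed in beta.\<close>
fun col :: "nat \<Rightarrow> odata \<Rightarrow> nat \<Rightarrow> bool" where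
  "col m D 0 = True"
| "col m D (Suc 0) = True"
| "col m D (Suc (Suc i)) =
     (let l = prei m D (Suc (Suc i)) in
      if fst l = 0 \<and> snd l \<in> gsel GA D then \<not> col m D (Suc i) else col m D (Suc i))"

definition betaS :: "nat \<Rightarrow> nat \<Rightarrow> odata \<Rightarrow> (nat \<times> nat) set" where
  "betaS n m D = {prei m D i | i. 1 \<le> i \<and> i \<le> sum_list (fst D) - n \<and> col m D i}"

definition alphaS :: "nat \<Rightarrow> nat \<Rightarrow> odata \<Rightarrow> (nat \<times> nat) set" where
  "alphaS n m D = {prei m D i | i. 1 \<le> i \<and> i \<le> sum_list (fst D) - n \<and> \<not> col m D i}"

definition TTcond :: "nat \<Rightarrow> nat \<Rightarrow> nat \<Rightarrow> abc \<Rightarrow> odata \<Rightarrow> bool" where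
  "TTcond n m k g D = (case D of (N, pm, A, B, C) \<Rightarrow>
     (\<forall>s. s + 1 < N ! 0 \<longrightarrow>
          (s \<in> B \<longrightarrow> pm (0, s) \<in> alphaS n m D) \<and> (s \<in> A \<longrightarrow> pm (0, s) \<in> betaS n m D)) \<and>
     (\<forall>r. k < r \<and> r < m \<longrightarrow> N ! (r + n - m) = 1) \<and>
     (\<forall>s. 0 < s \<and> s < N ! (k + n - m) \<longrightarrow>
          snd (pm (k + n - m, s)) > snd (pm (0, 0)) \<longrightarrow> pm (k + n - m, s) \<in> betaS n m D) \<and>
     (g = GA \<longrightarrow> (\<forall>s. 0 < s \<and> s < N ! (k + n - m) \<longrightarrow>
          snd (pm (k + n - m, s)) > snd (pm (0, 0)))))"

definition TTset :: "nat \<Rightarrow> nat \<Rightarrow> nat \<Rightarrow> abc \<Rightarrow> odata set" where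
  "TTset n m k g = {odata n m P | P. star_orbit n m P \<and> Pcond k g (odata n m P)
                                      \<and> TTcond n m k g (odata n m P)}"

definition oseg :: "nat \<Rightarrow> nat \<Rightarrow> nat \<Rightarrow> nat \<Rightarrow> nat set" where
  "oseg n m r s = {(r + j * m) mod n | j. j \<le> (LEAST j. (r + j * m) mod n = s)}"

definition Aset :: "nat \<Rightarrow> nat \<Rightarrow> nat set" where
  "Aset n m = {k. k < m \<and> {k + 1..<m} \<inter> oseg n m k 0 = {}}"

definition kth :: "nat \<Rightarrow> nat \<Rightarrow> nat \<Rightarrow> nat" where
  "kth n m i = sorted_list_of_set (Aset n m) ! (i - 1)"

definition Rseg :: "nat \<Rightarrow> nat \<Rightarrow> nat \<Rightarrow> nat set" where
  "Rseg n m i = oseg n m m (kth n m (i + 1) + n - m)"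
definition Sseg :: "nat \<Rightarrow> nat \<Rightarrow> nat \<Rightarrow> nat set" where
  "Sseg n m i = oseg n m (kth n m (i + 1)) (kth n m i + n - m)"
definition Tseg :: "nat \<Rightarrow> nat \<Rightarrow> nat \<Rightarrow> nat set" where
  "Tseg n m i = oseg n m (kth n m i) 0"

definition Dexp :: "nat \<Rightarrow> nat \<Rightarrow> nat \<Rightarrow> rat \<Rightarrow> odata" where
  "Dexp n m i x =
    (let p = nat (fst (quotient_of x)); q = nat (snd (quotient_of x));
         ki = kth n m i; kj = kth n m (i + 1);
         N = map (\<lambda>r. if r \<in> Rseg n m i then 1
                      else if r \<in> Sseg n m i then q + 1 - p
                      else if r \<in> Tseg n m i then q + 1 else 0) [0..<n];
         pm = (\<lambda>l. if l \<in> labels N then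
                 (let r = fst l; s = snd l in
                  if r = 0 \<and> s < p then (ki, q - p + s)
                  else if r = 0 \<and> s = p then (kj, q - p)
                  else if r = 0 \<and> p + 1 \<le> s \<and> s < q then (kj, s - p)
                  else if r = 0 \<and> s = q then (m, 0)
                  else if r = ki + n - m \<and> s = q - p then (ki, q)
                  else ((r + m) mod n, s))
               else undefined)
     in (N, pm, {p}, {0..<q} - {p}, {q}))"

end

theory Submission
  imports Defs
begin

text \<open>List the edges as \<open>m, 2m, \<dots>, nm = 0\<close> modulo \<open>n\<close>. A star orbit is transported along this list
  without change of order, and new points enter an edge \<open>r \<le> m\<close> only from \<open>e\<^sub>0\<close>. Write \<open>k\<close> and \<open>l\<close> for
  two consecutive elements of \<open>\<A>\<close>: every other edge strictly between \<open>k\<close> and \<open>m\<close> is listed before \<open>l\<close>, and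
  \<open>l\<close> before \<open>k\<close>. Condition (b) then says that points enter only at \<open>k\<close>, \<open>l\<close> and, once, at \<open>m\<close>. Colours are
  transported as well, and by (a) the only point of \<open>\<beta>\<close> on \<open>e\<^sub>0\<close> is the last one; tracing it back shows that
  a single point of \<open>e\<^sub>0\<close> is orientation reversing, and (c) fixes how the two streams merge at \<open>k\<close>.
  What remains is the data of some pair \<open>(p, q)\<close>; a common divisor \<open>d\<close> of \<open>p\<close> and \<open>q\<close> would give the
  invariant set of labels \<open>(r, s)\<close> with \<open>d dvd s\<close>, so \<open>p / q\<close> is in lowest terms.

  Conversely, for coprime \<open>p < q\<close> the first return to \<open>e\<^sub>0\<close> is essentially the rotation by \<open>-p\<close> modulo \<open>q\<close>,
  so the prescribed permutation is a single cycle. Positions realising it are the fixed point of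
  a composition of inverse branches, which is an affine contraction.\<close>

text \<open>Three devices recur. (1) A nonempty invariant subset of a cycle is the whole cycle. The
  contraction yields positions only in the closed unit interval and in no evident order; positions 0
  and 1 and inverted pairs are excluded because they would spread to all labels. (2) A strictly
  increasing self-map of an initial segment is the identity. Once the labels of an edge are counted,
  order alone fixes the permutation; merging streams are first glued into one such map. (3) The
  colouring is a recursion along inverse iterates, awkward for local arguments. Started at
  \<open>(m, 0)\<close>, the cycle first runs through the \<open>n\<close> labels
  \<open>(r, 0)\<close>, so the backward times from 1 to \<open>#P - n\<close> give exactly the
  other labels, and the recursion becomes a rule relating a label to its image. All solutions of the
  rule agree on these labels: a given orbit may be coloured abstractly, the prescribed data by a
  formula. Geometry enters only through the index j of the piece of \<open>e_0\<close> that contains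
  a point: its image lies on edge \<open>(j + 1) div 2\<close>, and the parity of j gives the
  orientation.\<close>

lemma strict_increasing_self_map_id:
  fixes f :: "nat \<Rightarrow> nat"
  assumes mono: "\<And>s t. s < t \<Longrightarrow> t < N \<Longrightarrow> f s < f t"
    and bound: "\<And>s. s < N \<Longrightarrow> f s < N" and "s < N"
  shows "f s = s"
proof -
  have lower: "s \<le> f s" if "s < N" for s
    using that
  proof (induction s)
    case (Suc s)
    then have "f s < f (Suc s)" using mono by blast
    with Suc show ?case by fastforce
  qed simp
  have upper: "f s + (N - s) \<le> N" if "s < N" for s
    using that
  proof (induction "N - s" arbitrary: s)
    case (Suc d)
    show ?case
    proof (cases "Suc s < N")
      case True
      then have "f (Suc s) + (N - Suc s) \<le> N" using Suc by simp
      moreover have "f s < f (Suc s)" using mono True by blast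
      ultimately show ?thesis using True by linarith
    next
      case False
      then show ?thesis using bound[OF Suc.prems] Suc.prems by linarith
    qed
  qed simp
  show ?thesis using lower[OF \<open>s < N\<close>] upper[OF \<open>s < N\<close>] \<open>s < N\<close> by linarith
qed

section \<open>Cyclic maps\<close>

locale cyclic_map =
  fixes f :: "'a \<Rightarrow> 'a" and L :: "'a set"
  assumes finite_carrier: "finite L"
    and nonempty: "L \<noteq> {}"
    and closed: "y \<in> L \<Longrightarrow> f y \<in> L"
    and reachable: "y \<in> L \<Longrightarrow> z \<in> L \<Longrightarrow> \<exists>j. (f ^^ j) y = z"
begin

lemma funpow_closed: "y \<in> L \<Longrightarrow> (f ^^ j) y \<in> L"
  by (induction j) (auto simp: closed)

lemma surj: "f ` L = L"
proof
  show "f ` L \<subseteq> L" using closed by auto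
  show "L \<subseteq> f ` L"
  proof
    fix z assume z: "z \<in> L"
    obtain j where "(f ^^ j) (f z) = z" using reachable[OF closed[OF z] z] by blast
    then have "f ((f ^^ j) z) = z" by (simp add: funpow_swap1)
    then show "z \<in> f ` L" using funpow_closed[OF z] by (metis imageI)
  qed
qed

lemma inj: "inj_on f L"
  using finite_carrier surj by (simp add: eq_card_imp_inj_on)

lemma inv_into_apply: "y \<in> L \<Longrightarrow> inv_into L f (f y) = y"
  using inj by simp

text \<open>The forward orbit of \<open>a\<close> stays in \<open>Q\<close> and is already
  everything. This is how a single bad label is shown to make every label bad.\<close>

lemma invariant_subset:
  assumes "Q \<subseteq> L" "a \<in> Q" "\<And>y. y \<in> Q \<Longrightarrow> f y \<in> Q"
  shows "Q = L"
proof
  show "L \<subseteq> Q"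
  proof
    fix z assume "z \<in> L"
    moreover have "a \<in> L" using assms by blast
    ultimately obtain j where "(f ^^ j) a = z" using reachable by blast
    moreover have "(f ^^ j) a \<in> Q" by (induction j) (auto simp: assms)
    ultimately show "z \<in> Q" by simp
  qed
qed (fact assms)

text \<open>A repetition at times \<open>i < j\<close> would make the values at times
  \<open>i, ..., j - 1\<close> an invariant set with fewer than \<open>card L\<close>
  elements.\<close>

lemma funpow_inj:
  assumes "a \<in> L" "i < card L" "j < card L" "(f ^^ i) a = (f ^^ j) a"
  shows "i = j"
proof -
  have *: False if ij: "i < j" "j < card L" "(f ^^ i) a = (f ^^ j) a" for i j
  proof -
    let ?Q = "(\<lambda>t. (f ^^ t) a) ` {i..<j}"
    have step: "f y \<in> ?Q" if "y \<in> ?Q" for y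
    proof -
      from that obtain t where t: "i \<le> t" "t < j" "y = (f ^^ t) a" by auto
      show ?thesis
      proof (cases "Suc t = j")
        case True
        then have "f y = (f ^^ i) a" using t ij by (metis funpow.simps(2) o_apply)
        then show ?thesis using ij by (intro image_eqI[of _ _ i]) auto
      next
        case False
        then show ?thesis using t by (intro image_eqI[of _ _ "Suc t"]) auto
      qed
    qed
    have "?Q = L"
    proof (rule invariant_subset[OF _ _ step])
      show "(f ^^ i) a \<in> ?Q" using ij by (intro image_eqI[of _ _ i]) auto
      show "?Q \<subseteq> L" using funpow_closed[OF assms(1)] by auto
    qed
    then have "card L \<le> j - i" using card_image_le[of "{i..<j}" "\<lambda>t. (f ^^ t) a"] by simp
    then show False using ij by linarith
  qed
  show ?thesis using *[of i j] *[of j i] assms by (metis linorder_neqE_nat)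
qed

lemma funpow_image: 
  assumes "a \<in> L" shows "(\<lambda>j. (f ^^ j) a) ` {..<card L} = L"
proof -
  have "inj_on (\<lambda>j. (f ^^ j) a) {..<card L}"
    using funpow_inj[OF assms] by (auto intro: inj_onI)
  then have "card ((\<lambda>j. (f ^^ j) a) ` {..<card L}) = card L" by (simp add: card_image)
  moreover have "(\<lambda>j. (f ^^ j) a) ` {..<card L} \<subseteq> L" using funpow_closed[OF assms] by auto
  ultimately show ?thesis using finite_carrier by (simp add: card_subset_eq)
qed

lemma funpow_card:
  assumes "a \<in> L" shows "(f ^^ card L) a = a"
proof -
  have pos: "0 < card L" using finite_carrier nonempty by (simp add: card_gt_0_iff)
  obtain t where t: "t < card L" "(f ^^ card L) a = (f ^^ t) a"
    using funpow_image[OF assms] funpow_closed[OF assms, of "card L"]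
    by (smt (verit, best) imageE lessThan_iff)
  show ?thesis
  proof (cases t)
    case 0
    then show ?thesis using t by simp
  next
    case (Suc t')
    obtain c where c: "card L = Suc c" using pos gr0_implies_Suc by blast
    have "f ((f ^^ c) a) = f ((f ^^ t') a)" using t c Suc by simp
    then have "(f ^^ c) a = (f ^^ t') a"
      using inj funpow_closed[OF assms] by (meson inj_onD)
    then have "c = t'" using funpow_inj[OF assms, of c t'] c t Suc by simp
    then show ?thesis using t c Suc by simp
  qed
qed

text \<open>Converts the inverse iterates in the definition of \<open>prei\<close> into forward
  iterates.\<close>

lemma inv_into_funpow:
  assumes "a \<in> L" "i \<le> card L"
  shows "(inv_into L f ^^ i) a = (f ^^ (card L - i)) a"
  using assms(2)
proof (induction i)
  case 0
  then show ?case using funpow_card[OF assms(1)] by simp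
next
  case (Suc i)
  have "(inv_into L f ^^ Suc i) a = inv_into L f ((f ^^ (card L - i)) a)"
    using Suc by simp
  also have "(f ^^ (card L - i)) a = f ((f ^^ (card L - Suc i)) a)"
    using Suc.prems by (metis Suc_diff_Suc Suc_le_eq funpow.simps(2) o_apply)
  also have "inv_into L f \<dots> = (f ^^ (card L - Suc i)) a"
    by (rule inv_into_apply) (rule funpow_closed[OF assms(1)])
  finally show ?case .
qed

end

lemma periodic_orbit_cyclic_map:
  assumes "0 < k" "(f ^^ k) x = x" "L = {(f ^^ j) x | j. j < k}"
  shows "cyclic_map f L"
proof -
  have per: "(f ^^ j) x \<in> L" for j
  proof -
    have "(f ^^ j) x = (f ^^ (j mod k)) x" using assms(2) by (metis funpow_mod_eq)
    then show ?thesis using assms by (metis (mono_tags, lifting) mem_Collect_eq mod_less_divisor)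
  qed
  show ?thesis
  proof
    show "finite L" unfolding assms(3) by (simp add: setcompr_eq_image lessThan_def[symmetric])
    show "L \<noteq> {}" using per by blast
    fix y assume "y \<in> L"
    then obtain j where j: "y = (f ^^ j) x" "j < k" using assms(3) by auto
    then have "f y = (f ^^ Suc j) x" by simp
    then show "f y \<in> L" using per by metis
    fix z assume "z \<in> L"
    then obtain i where i: "z = (f ^^ i) x" using assms(3) by auto
    have "(f ^^ (i + (k - j))) y = (f ^^ i) ((f ^^ ((k - j) + j)) x)"
      by (simp add: j funpow_add)
    also have "\<dots> = z" using j i assms(2) by simp
    finally show "\<exists>j. (f ^^ j) y = z" by blast
  qed
qed

lemma labels_map: "labels (map N [0..<n]) = (SIGMA r:{..<n}. {..<N r})"
  by (auto simp: labels_def)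

lemma card_labels: "card (labels (map N [0..<n])) = sum_list (map N [0..<n])"
  unfolding labels_map by (simp add: interv_sum_list_conv_sum_set_nat atLeast0LessThan)

section \<open>The colouring of an orbit\<close>

text \<open>Collects what the colouring needs to know: the first \<open>n\<close> iterates of
  \<open>(m, 0)\<close> are the labels with second coordinate 0, so that the labels to be coloured
  fill the rest of the cycle.\<close>

locale coloured_orbit = cyclic_map pm "labels N"
  for pm :: "nat \<times> nat \<Rightarrow> nat \<times> nat" and N :: "nat list" +
  fixes m n :: nat and A B C :: "nat set"
  assumes card_labels_N: "card (labels N) = sum_list N"
    and n_positive: "0 < n"
    and m_0_in: "(m, 0) \<in> labels N"
    and mins: "(\<lambda>j. (pm ^^ j) (m, 0)) ` {..<n} = {y \<in> labels N. snd y = 0}"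
    and card_mins: "card {y \<in> labels N. snd y = 0} = n"
begin

abbreviation "D \<equiv> (N, pm, A, B, C)"
abbreviation "M \<equiv> card (labels N)"

lemma n_le_M: "n \<le> M"
  using card_mono[OF finite_carrier, of "{y \<in> labels N. snd y = 0}"] card_mins by auto

lemma prei_eq: "i \<le> M \<Longrightarrow> prei m D i = (pm ^^ (M - i)) (m, 0)"
  unfolding prei_def using inv_into_funpow[OF m_0_in] by simp

lemma snd_funpow_pos_iff:
  assumes "j < M" shows "0 < snd ((pm ^^ j) (m, 0)) \<longleftrightarrow> n \<le> j"
proof -
  have "snd ((pm ^^ j) (m, 0)) = 0 \<longleftrightarrow> (pm ^^ j) (m, 0) \<in> (\<lambda>j. (pm ^^ j) (m, 0)) ` {..<n}"
    unfolding mins using funpow_closed[OF m_0_in] by simp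
  also have "\<dots> \<longleftrightarrow> j < n"
  proof
    assume "(pm ^^ j) (m, 0) \<in> (\<lambda>j. (pm ^^ j) (m, 0)) ` {..<n}"
    then obtain i where i: "i < n" "(pm ^^ j) (m, 0) = (pm ^^ i) (m, 0)" by auto
    then have "j = i" using funpow_inj[OF m_0_in assms, of i] n_le_M by simp
    then show "j < n" using i by simp
  qed auto
  finally show ?thesis by linarith
qed

text \<open>Backward time \<open>i\<close> is forward time \<open>M - i\<close>, so
  \<open>1..M - n\<close> corresponds to the forward times \<open>n..M - 1\<close>, after the run
  through the labels \<open>(r, 0)\<close>.\<close>

lemma prei_image: "prei m D ` {1..M - n} = {y \<in> labels N. 0 < snd y}"
proof
  show "prei m D ` {1..M - n} \<subseteq> {y \<in> labels N. 0 < snd y}"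
  proof
    fix y assume "y \<in> prei m D ` {1..M - n}"
    then obtain i where i: "1 \<le> i" "i \<le> M - n" "y = prei m D i" by auto
    then have y: "y = (pm ^^ (M - i)) (m, 0)" using prei_eq by simp
    moreover have "M - i < M" "n \<le> M - i" using i n_le_M n_positive by linarith+
    ultimately show "y \<in> {y \<in> labels N. 0 < snd y}"
      using snd_funpow_pos_iff funpow_closed[OF m_0_in] by simp
  qed
  show "{y \<in> labels N. 0 < snd y} \<subseteq> prei m D ` {1..M - n}"
  proof
    fix y assume y: "y \<in> {y \<in> labels N. 0 < snd y}"
    then obtain j where j: "j < M" "y = (pm ^^ j) (m, 0)"
      using funpow_image[OF m_0_in] by (smt (verit) imageE lessThan_iff mem_Collect_eq)
    then have "n \<le> j" using snd_funpow_pos_iff y by blast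
    then show "y \<in> prei m D ` {1..M - n}"
      using j prei_eq[of "M - j"] by (intro image_eqI[of _ _ "M - j"]) auto
  qed
qed

lemma prei_in: "1 \<le> i \<Longrightarrow> i \<le> M - n \<Longrightarrow> prei m D i \<in> labels N \<and> 0 < snd (prei m D i)"
  using prei_image by (metis (no_types, lifting) atLeastAtMost_iff imageI mem_Collect_eq)

lemma prei_inj: "inj_on (prei m D) {1..M - n}"
proof (rule inj_onI)
  fix i j assume ij: "i \<in> {1..M - n}" "j \<in> {1..M - n}" "prei m D i = prei m D j"
  then have "M - i = M - j" using prei_eq funpow_inj[OF m_0_in, of "M - i" "M - j"] by auto
  then show "i = j" using ij by auto
qed

lemma pm_prei: "i < M \<Longrightarrow> pm (prei m D (Suc i)) = prei m D i"
  using prei_eq[of i] prei_eq[of "Suc i"]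
  by (metis Suc_diff_Suc Suc_leI funpow.simps(2) less_imp_le_nat o_apply)

lemma prei_0: "prei m D 0 = (m, 0)" by (simp add: prei_def)

text \<open>The defining recursion of the colouring, read along \<^term>\<open>pm\<close> instead of its inverse.\<close>

definition colour_law :: "(nat \<times> nat \<Rightarrow> bool) \<Rightarrow> bool" where
  "colour_law c \<longleftrightarrow> (\<forall>y \<in> labels N. 0 < snd y \<longrightarrow>
     (if pm y = (m, 0) then c y else c y = (c (pm y) \<noteq> (fst y = 0 \<and> snd y \<in> A))))"

lemma col_eq:
  assumes "colour_law c" "1 \<le> i" "i \<le> M - n"
  shows "col m D i = c (prei m D i)"
  using assms(2,3)
proof (induction i rule: nat_induct_at_least)
  case base
  have y: "prei m D 1 \<in> labels N" "0 < snd (prei m D 1)" using prei_in base by (metis le_refl)+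
  have "pm (prei m D 1) = (m, 0)" using pm_prei[of 0] prei_0 base by simp
  then show ?case using assms(1) y unfolding colour_law_def by (metis One_nat_def col.simps(2))
next
  case (Suc i)
  let ?y = "prei m D (Suc i)"
  have y: "?y \<in> labels N" "0 < snd ?y" using prei_in[of "Suc i"] Suc.prems Suc.hyps by (metis le_SucI)+
  have py: "pm ?y = prei m D i" using pm_prei[of i] Suc n_positive by simp
  \<comment> \<open>Positivity keeps the image away from \<open>(m, 0)\<close>, so the initial value
    of the recursion is used at time 1 only.\<close>
  have "0 < snd (prei m D i)" using prei_in[of i] Suc by linarith
  then have "pm ?y \<noteq> (m, 0)" using py by auto
  then have "c ?y = (c (prei m D i) \<noteq> (fst ?y = 0 \<and> snd ?y \<in> A))"
    using assms(1) y py unfolding colour_law_def by metis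
  moreover obtain i' where "i = Suc i'" using Suc by (cases i) auto
  ultimately show ?case using Suc by (auto simp: Let_def)
qed

text \<open>By \<open>col_eq\<close> every solution of the law coincides with \<open>col\<close>, so
  membership in \<alpha> and \<beta> can be decided with whichever solution is convenient.\<close>

lemma colour_sets:
  assumes "colour_law c"
  shows "betaS n m D = {y \<in> labels N. 0 < snd y \<and> c y}"
    and "alphaS n m D = {y \<in> labels N. 0 < snd y \<and> \<not> c y}"
proof -
  have img: "prei m D ` {i \<in> {1..M - n}. Q (prei m D i)} = {y \<in> labels N. 0 < snd y \<and> Q y}" for Q
  proof -
    have "f ` {i \<in> I. Q (f i)} = {y \<in> f ` I. Q y}" for f :: "nat \<Rightarrow> nat \<times> nat" and I by blast
    then have "prei m D ` {i \<in> {1..M - n}. Q (prei m D i)} = {y \<in> prei m D ` {1..M - n}. Q y}" .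
    also have "\<dots> = {y \<in> labels N. 0 < snd y \<and> Q y}" unfolding prei_image by blast
    finally show ?thesis .
  qed
  have b: "betaS n m D = prei m D ` {i \<in> {1..M - n}. c (prei m D i)}"
  proof -
    have "betaS n m D = prei m D ` {i \<in> {1..M - n}. col m D i}"
      unfolding betaS_def fst_conv card_labels_N by (simp add: setcompr_eq_image)
    also have "{i \<in> {1..M - n}. col m D i} = {i \<in> {1..M - n}. c (prei m D i)}"
      using col_eq[OF assms] by (intro Collect_cong conj_cong refl) simp
    finally show ?thesis .
  qed
  have a: "alphaS n m D = prei m D ` {i \<in> {1..M - n}. \<not> c (prei m D i)}"
  proof -
    have "alphaS n m D = prei m D ` {i \<in> {1..M - n}. \<not> col m D i}"
      unfolding alphaS_def fst_conv card_labels_N by (simp add: setcompr_eq_image)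
    also have "{i \<in> {1..M - n}. \<not> col m D i} = {i \<in> {1..M - n}. \<not> c (prei m D i)}"
      using col_eq[OF assms] by (intro Collect_cong conj_cong refl) simp
    finally show ?thesis .
  qed
  show "betaS n m D = {y \<in> labels N. 0 < snd y \<and> c y}"
    unfolding b by (rule img)
  show "alphaS n m D = {y \<in> labels N. 0 < snd y \<and> \<not> c y}"
    unfolding a by (rule img)
qed

text \<open>\<open>prei\<close> enumerates the positive labels injectively, so \<open>col\<close>
  can be carried from times to labels.\<close>

lemma colour_law_exists: "\<exists>c. colour_law c"
proof
  let ?ix = "inv_into {1..M - n} (prei m D)"
  let ?c = "\<lambda>y. col m D (?ix y)"
  have c: "?c (prei m D i) = col m D i" if "i \<in> {1..M - n}" for i
    using prei_inj that by simp
  show "colour_law ?c"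
    unfolding colour_law_def
  proof (intro ballI impI)
    fix y assume "y \<in> labels N" "0 < snd y"
    then obtain i where i: "i \<in> {1..M - n}" "y = prei m D i" using prei_image by blast
    then obtain i' where i': "i = Suc i'" by (cases i) auto
    have py: "pm y = prei m D i'" using pm_prei[of i'] i i' n_positive by auto
    show "if pm y = (m, 0) then ?c y else ?c y = (?c (pm y) \<noteq> (fst y = 0 \<and> snd y \<in> A))"
    proof (cases i')
      case 0
      then show ?thesis using c[OF i(1)] i i' py prei_0 by simp
    next
      case (Suc i'')
      have i'M: "i' \<in> {1..M - n}" using i i' Suc by auto
      then have "0 < snd (pm y)" using py prei_in[of i'] by auto
      then have "pm y \<noteq> (m, 0)" by auto
      then show ?thesis using c[OF i(1)] c[OF i'M] i i' py Suc by (simp add: Let_def)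
    qed
  qed
qed

end

section \<open>The orbit of the edges\<close>

text \<open>The shift by one puts \<open>m\<close> at position 0 and the edge 0, the only one that
  is not mapped isometrically, at the last position \<open>n - 1\<close>.\<close>

definition edge_at :: "nat \<Rightarrow> nat \<Rightarrow> nat \<Rightarrow> nat" where
  "edge_at n m j = (Suc j * m) mod n"

definition pos :: "nat \<Rightarrow> nat \<Rightarrow> nat \<Rightarrow> nat" where
  "pos n m r = inv_into {..<n} (edge_at n m) r"

locale rotation =
  fixes n m :: nat
  assumes coprime: "coprime m n" and m_gt_1: "1 < m" and m_small: "2 * m < n"
begin

abbreviation "E \<equiv> edge_at n m"
abbreviation "ps \<equiv> pos n m"

lemma E_less: "E j < n"
  using m_small by (simp add: edge_at_def)

lemma E_inj: assumes "i < n" "j < n" "E i = E j" shows "i = j"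
proof -
  have *: "i = j" if "i \<le> j" "j < n" "E i = E j" for i j
  proof -
    have "n dvd Suc j * m - Suc i * m"
      using that by (metis edge_at_def mod_eq_dvd_iff_nat mult_le_mono1 Suc_le_mono)
    then have "n dvd (j - i) * m" by (simp add: diff_mult_distrib)
    then have "n dvd j - i" using coprime by (metis coprime_commute coprime_dvd_mult_left_iff)
    then show ?thesis using that by (metis diff_is_0_eq' dvd_imp_le le_antisym less_imp_diff_less not_less zero_less_iff_neq_zero diff_diff_cancel diff_zero)
  qed
  show ?thesis using *[of i j] *[of j i] assms by (metis nat_le_linear)
qed

lemma E_image: "E ` {..<n} = {..<n}"
proof -
  have "inj_on E {..<n}" using E_inj by (auto intro: inj_onI)
  then show ?thesis using E_less
    by (intro card_subset_eq) (auto simp: card_image)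
qed

lemma ps_less: "r < n \<Longrightarrow> ps r < n"
  unfolding pos_def using E_image inv_into_into[of r E "{..<n}"] by auto

lemma E_ps: "r < n \<Longrightarrow> E (ps r) = r"
  unfolding pos_def using E_image by (simp add: f_inv_into_f)

lemma ps_E: "j < n \<Longrightarrow> ps (E j) = j"
  using E_inj E_ps E_less ps_less by blast

lemma E_0: "E 0 = m" using m_small by (simp add: edge_at_def)

lemma E_last: "E (n - 1) = 0"
  using m_small by (simp add: edge_at_def)

lemma E_Suc: "E (Suc j) = (E j + m) mod n"
  by (simp add: edge_at_def mod_simps add_ac)

lemma E_add: "E (j + t) = (E j + t * m) mod n"
  by (induction t) (auto simp: E_Suc E_less mod_simps algebra_simps)

lemma ps_m: "ps m = 0" using ps_E[of 0] E_0 m_small by simp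
lemma ps_0: "ps 0 = n - 1" using ps_E[of "n - 1"] E_last m_small by simp

lemma ps_pos: "r < n \<Longrightarrow> r \<noteq> m \<Longrightarrow> 0 < ps r"
  using E_ps E_0 by (metis gr0I)

lemma ps_eq_last_iff: "r < n \<Longrightarrow> ps r = n - 1 \<longleftrightarrow> r = 0"
  using E_ps E_last ps_0 by metis

lemma E_eq_0_iff: "j < n \<Longrightarrow> E j = 0 \<longleftrightarrow> j = n - 1"
  using ps_E ps_0 E_last by metis

lemma ps_step:
  assumes "r < n" "r \<noteq> 0"
  shows "ps ((r + m) mod n) = Suc (ps r)"
proof -
  have "Suc (ps r) < n" using ps_less ps_eq_last_iff assms by (metis Suc_lessI diff_Suc_1)
  moreover have "E (Suc (ps r)) = (r + m) mod n" using E_Suc E_ps assms by simp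
  ultimately show ?thesis using ps_E by metis
qed

lemma prev_edge:
  assumes "r < m"
  shows "r + n - m < n" "r + n - m \<noteq> 0" "(r + n - m + m) mod n = r" 
    "ps r = Suc (ps (r + n - m))"
proof -
  show a: "r + n - m < n" "r + n - m \<noteq> 0" using assms m_small by linarith+
  have "r + n - m + m = r + n" using m_small by linarith
  then show "(r + n - m + m) mod n = r" using assms m_small by simp
  then show "ps r = Suc (ps (r + n - m))" using ps_step[OF a] by simp
qed

lemma mod_step_cases:
  assumes "r < n"
  shows "(r + m) mod n = (if r + m < n then r + m else r + m - n)"
  using assms m_small by (simp add: mod_if)

lemma oseg_eq:
  assumes "i \<le> j" "j < n"
  shows "oseg n m (E i) (E j) = E ` {i..j}"
proof -
  have shift: "(E i + t * m) mod n = E (i + t)" for t using E_add by simp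
  \<comment> \<open>No wrap-around occurs before position \<open>j\<close>, so injectivity of
    \<open>E\<close> makes \<open>j - i\<close> the first hit.\<close>
  have least: "(LEAST t. (E i + t * m) mod n = E j) = j - i"
  proof (rule Least_equality)
    show "(E i + (j - i) * m) mod n = E j" using assms shift by simp
    fix t assume t: "(E i + t * m) mod n = E j"
    show "j - i \<le> t"
    proof (rule ccontr)
      assume "\<not> j - i \<le> t"
      then have "i + t < j" by linarith
      then show False using t shift E_inj[of "i + t" j] assms by simp
    qed
  qed
  have "oseg n m (E i) (E j) = (\<lambda>t. E (i + t)) ` {..j - i}"
    unfolding oseg_def least by (auto simp: shift)
  also have "\<dots> = E ` ((\<lambda>t. i + t) ` {..j - i})" by (simp add: image_image)
  also have "(\<lambda>t. i + t) ` {..j - i} = {i..j}"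
    using assms by (simp add: atMost_atLeast0)
  finally show ?thesis .
qed

lemma oseg_iff:
  assumes "a < n" "b < n" "ps a \<le> ps b" "r < n"
  shows "r \<in> oseg n m a b \<longleftrightarrow> ps a \<le> ps r \<and> ps r \<le> ps b"
proof -
  have "oseg n m a b = E ` {ps a..ps b}"
    using oseg_eq[OF assms(3) ps_less[OF assms(2)]] E_ps assms by simp
  then have "r \<in> oseg n m a b \<longleftrightarrow> r \<in> E ` {ps a..ps b}" by simp
  also have "\<dots> \<longleftrightarrow> ps r \<in> {ps a..ps b}"
  proof
    assume "r \<in> E ` {ps a..ps b}"
    then obtain j where "j \<in> {ps a..ps b}" "r = E j" by auto
    moreover have "j < n" using calculation ps_less[OF assms(2)] by auto
    ultimately show "ps r \<in> {ps a..ps b}" using ps_E by simp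
  next
    assume "ps r \<in> {ps a..ps b}"
    then show "r \<in> E ` {ps a..ps b}" using E_ps[OF assms(4)] by (metis imageI)
  qed
  finally show ?thesis by simp
qed

text \<open>Since 0 is listed last, the segment from \<open>k\<close> to 0 is the tail of the list
  starting at \<open>ps k\<close>. Thus the set consists of the right-to-left maxima of
  \<open>ps\<close> on \<open>{0..<m}\<close>.\<close>

lemma Aset_iff: "k \<in> Aset n m \<longleftrightarrow> k < m \<and> (\<forall>r. k < r \<and> r < m \<longrightarrow> ps r < ps k)"
proof (cases "k < m")
  case True
  have le: "ps r \<le> ps 0" if "r < n" for r using ps_less[OF that] ps_0 by linarith
  have "r \<in> oseg n m k 0 \<longleftrightarrow> ps k \<le> ps r" if "r < m" for r
    using oseg_iff[of k 0 r] le True that m_small by simp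
  then have "({k + 1..<m} \<inter> oseg n m k 0 = {}) \<longleftrightarrow> (\<forall>r. k < r \<and> r < m \<longrightarrow> \<not> ps k \<le> ps r)"
    by (auto simp: disjoint_iff)
  then show ?thesis unfolding Aset_def using True by (auto simp: not_le)
qed (simp add: Aset_def)

end

locale rotation_pair = rotation +
  fixes k l :: nat
  assumes k_less_l: "k < l" and l_less_m: "l < m" and ps_l_k: "ps l < ps k"
    and ps_between: "\<And>r. k < r \<Longrightarrow> r < m \<Longrightarrow> r \<noteq> l \<Longrightarrow> ps r < ps l"
begin

lemma ps_l_pos: "0 < ps l" using ps_pos l_less_m m_small by simp

lemma kl_less: "k < n" "l < n" "k < m" "m < n" using k_less_l l_less_m m_small by linarith+

text \<open>Each segment ends at the predecessor of the first edge of the next one, so R, S and T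
  become the intervals of positions cut at \<open>ps l\<close> and \<open>ps k\<close>.\<close>

lemma oseg_R: "r < n \<Longrightarrow> r \<in> oseg n m m (l + n - m) \<longleftrightarrow> ps r < ps l"
  using oseg_iff[of m "l + n - m" r] prev_edge[OF l_less_m] kl_less by (auto simp: ps_m)

lemma oseg_S: "r < n \<Longrightarrow> r \<in> oseg n m l (k + n - m) \<longleftrightarrow> ps l \<le> ps r \<and> ps r < ps k"
  using oseg_iff[of l "k + n - m" r] prev_edge[of k] kl_less ps_l_k by auto

lemma oseg_T: "r < n \<Longrightarrow> r \<in> oseg n m k 0 \<longleftrightarrow> ps k \<le> ps r"
  using oseg_iff[of k 0 r] kl_less ps_less[of r] ps_less[of k] by (auto simp: ps_0)

end

lemma (in rotation) rotation_pair_kth: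
  assumes "1 \<le> i" "i < card (Aset n m)"
  shows "rotation_pair n m (kth n m i) (kth n m (i + 1))"
proof -
  let ?xs = "sorted_list_of_set (Aset n m)"
  let ?k = "kth n m i" let ?l = "kth n m (i + 1)"
  have fin: "finite (Aset n m)" by (simp add: Aset_def)
  have len: "length ?xs = card (Aset n m)" using fin by simp
  have k: "?k = ?xs ! (i - 1)" and l: "?l = ?xs ! i" by (simp_all add: kth_def)
  have kA: "?k \<in> Aset n m" unfolding k
    using nth_mem[of "i - 1" ?xs] len assms fin by simp
  have lA: "?l \<in> Aset n m" unfolding l
    using nth_mem[of i ?xs] len assms fin by simp
  have "sorted_wrt (<) ?xs" by simp
  then have kl: "?k < ?l" unfolding k l
    using assms len by (intro sorted_wrt_nth_less[of "(<)"]) auto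
  have gap: False if "r \<in> Aset n m" "?k < r" "r < ?l" for r
  proof -
    have "r \<in> set ?xs" using that(1) fin by simp
    then obtain t where t: "t < length ?xs" "r = ?xs ! t" unfolding in_set_conv_nth by blast
    have mono: "?xs ! a \<le> ?xs ! b" if "a \<le> b" "b < length ?xs" for a b
      using that by (intro sorted_nth_mono) auto
    have "i - 1 < t"
    proof (rule ccontr)
      assume "\<not> i - 1 < t"
      then have "r \<le> ?k" unfolding t(2) k by (intro mono) (use assms len in auto)
      then show False using that(2) by simp
    qed
    moreover have "t < i"
    proof (rule ccontr)
      assume "\<not> t < i"
      then have "?l \<le> r" unfolding t(2) l by (intro mono) (use t in auto)
      then show False using that(3) by simp
    qed
    ultimately show False by linarith
  qed
  have lm: "?l < m" using lA Aset_iff by blast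
  have between: "ps r < ps ?l" if r: "?k < r" "r < m" "r \<noteq> ?l" for r
  proof -
    txt \<open>The last of the edges between \<^term>\<open>k\<close> and \<^term>\<open>m\<close> on the orbit belongs to \<^term>\<open>Aset n m\<close>.\<close>
    have "Max (ps ` {?k<..<m}) \<in> ps ` {?k<..<m}" using r by (intro Max_in) auto
    then obtain g where g_eq: "g \<in> {?k<..<m}" "ps g = Max (ps ` {?k<..<m})" by (metis imageE)
    have g: "g \<in> {?k<..<m}" "\<And>r. r \<in> {?k<..<m} \<Longrightarrow> ps r \<le> ps g"
      using g_eq(1) unfolding g_eq(2) by auto
    have inj: "ps r \<noteq> ps g" if "r \<noteq> g" "r < m" for r
      using E_ps[of r] E_ps[of g] g(1) that m_small by auto
    have "g \<in> Aset n m"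
      unfolding Aset_iff using g inj by (metis greaterThanLessThan_iff less_trans nat_less_le)
    then have "?l \<le> g" using gap g by (meson greaterThanLessThan_iff not_less)
    moreover have "\<not> ?l < g"
    proof
      assume "?l < g"
      then have "ps g < ps ?l" using lA g(1) Aset_iff by auto
      then show False using g(2)[of ?l] kl lm by simp
    qed
    ultimately have "g = ?l" by simp
    then show ?thesis using g(2)[of r] inj[of r] r by (simp add: le_neq_implies_less)
  qed
  show ?thesis
  proof
    show "?k < ?l" "?l < m" by fact+
    show "ps ?l < ps ?k" using kA kl lm Aset_iff by blast
  qed (fact between)
qed

section \<open>Local types at points of a finite invariant set\<close>

text \<open>Even pieces run along an edge from its initial point to the centre, odd pieces run back.
  The ends of a piece are excluded because they go to the centre or to an initial point.\<close>

lemma fstar_piece: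
  assumes "0 < w" "w < 1" "(2 * real m + 1) * t = real j + w"
  shows "fstar n m (Ed 0 t) = Ed ((j + 1) div 2) (if even j then w else 1 - w)"
proof -
  have fl: "\<lfloor>(2 * real m + 1) * t\<rfloor> = int j"
    unfolding assms(3) using assms by (intro floor_unique) auto
  then have fl': "nat \<lfloor>(2 * real m + 1) * t\<rfloor> = j" by simp
  show ?thesis
  proof (cases "j = 0")
    case True
    then show ?thesis using fl' assms by (simp add: fstar_def Let_def)
  next
    case False
    then show ?thesis unfolding fstar_def using fl' assms(1,3) by (auto simp: Let_def)
  qed
qed

text \<open>At the first point of \<open>P\<close> on \<open>e_0\<close> the neighbourhood is
  one-sided, so comparison points are sought on the right, where \<open>t0 < 1\<close> leaves
  room.\<close>

lemma nbhd0_right: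
  assumes "Min (edge_pts P 0) \<le> t0" "t0 < 1" "0 < e"
  obtains t where "t0 < t" "t \<in> nbhd0 P t0 e" "t0 \<in> nbhd0 P t0 e"
proof
  define d where "d = min e (1 - t0) / 2"
  have d: "0 < d" "d < 1 - t0" "d < e" using assms by (auto simp: d_def min_def field_simps)
  show "t0 < t0 + d" using d by simp
  show "t0 + d \<in> nbhd0 P t0 e" using assms d by (auto simp: nbhd0_def)
  show "t0 \<in> nbhd0 P t0 e" using assms by (auto simp: nbhd0_def)
qed

lemma nbhd0_mono: "e \<le> e' \<Longrightarrow> nbhd0 P t0 e \<subseteq> nbhd0 P t0 e'"
  by (auto simp: nbhd0_def)

lemma local_type_affine:
  assumes "Min (edge_pts P 0) \<le> t0" "t0 < 1" "0 < e" "a \<noteq> 0"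
    and aff: "\<And>t. \<bar>t - t0\<bar> < e \<Longrightarrow> trunc n m P (Ed 0 t) = Ed r (y + a * (t - t0))"
  shows "loc_pres n m P t0 \<longleftrightarrow> 0 < a" "loc_rev n m P t0 \<longleftrightarrow> a < 0" "\<not> loc_noninj n m P t0"
proof -
  have par: "epar (trunc n m P (Ed 0 t)) = y + a * (t - t0)" if "t \<in> nbhd0 P t0 e" for t
    using aff[of t] that by (simp add: nbhd0_def epar_def)
  have edge: "\<forall>t\<in>nbhd0 P t0 e. on_edge r (trunc n m P (Ed 0 t))"
    using aff by (auto simp: nbhd0_def on_edge_def)
  \<comment> \<open>A local type comes with its own radius \<open>e'\<close>; refuting it needs two
    parameters that also lie where the map is known to be affine.\<close>
  have two: "\<exists>t1 t2. t1 < t2 \<and> t1 \<in> nbhd0 P t0 e \<and> t2 \<in> nbhd0 P t0 e 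
      \<and> t1 \<in> nbhd0 P t0 e' \<and> t2 \<in> nbhd0 P t0 e'" if "0 < e'" for e'
  proof -
    have "0 < min e e'" using \<open>0 < e\<close> that by simp
    then obtain t where "t0 < t" "t \<in> nbhd0 P t0 (min e e')" "t0 \<in> nbhd0 P t0 (min e e')"
      using nbhd0_right[OF assms(1,2)] by metis
    then show ?thesis using nbhd0_mono[of "min e e'" e] nbhd0_mono[of "min e e'" e'] 
      by (meson in_mono min.cobounded1 min.cobounded2)
  qed
  have pres: "loc_pres n m P t0" if "0 < a"
    unfolding loc_pres_def using \<open>0 < e\<close> edge that by (intro exI[of _ e] conjI exI[of _ r]) (auto simp: par)
  have rev: "loc_rev n m P t0" if "a < 0"
    unfolding loc_rev_def using \<open>0 < e\<close> edge that by (intro exI[of _ e] conjI exI[of _ r]) (auto simp: par)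
  show "loc_pres n m P t0 \<longleftrightarrow> 0 < a"
  proof
    assume "loc_pres n m P t0"
    then obtain e' where e': "0 < e'" "\<forall>t1\<in>nbhd0 P t0 e'. \<forall>t2\<in>nbhd0 P t0 e'. t1 < t2 \<longrightarrow>
          epar (trunc n m P (Ed 0 t1)) < epar (trunc n m P (Ed 0 t2))"
      unfolding loc_pres_def by blast
    obtain t1 t2 where t: "t1 < t2" "t1 \<in> nbhd0 P t0 e" "t2 \<in> nbhd0 P t0 e"
      "t1 \<in> nbhd0 P t0 e'" "t2 \<in> nbhd0 P t0 e'" using two[OF e'(1)] by blast
    then have "y + a * (t1 - t0) < y + a * (t2 - t0)" using e'(2) par by metis
    then have "0 < a * (t2 - t1)" by (simp add: algebra_simps)
    then show "0 < a" using t(1) by (simp add: zero_less_mult_iff)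
  qed (fact pres)
  show "loc_rev n m P t0 \<longleftrightarrow> a < 0"
  proof
    assume "loc_rev n m P t0"
    then obtain e' where e': "0 < e'" "\<forall>t1\<in>nbhd0 P t0 e'. \<forall>t2\<in>nbhd0 P t0 e'. t1 < t2 \<longrightarrow>
          epar (trunc n m P (Ed 0 t2)) < epar (trunc n m P (Ed 0 t1))"
      unfolding loc_rev_def by blast
    obtain t1 t2 where t: "t1 < t2" "t1 \<in> nbhd0 P t0 e" "t2 \<in> nbhd0 P t0 e"
      "t1 \<in> nbhd0 P t0 e'" "t2 \<in> nbhd0 P t0 e'" using two[OF e'(1)] by blast
    then have "y + a * (t2 - t0) < y + a * (t1 - t0)" using e'(2) par by metis
    then have "a * (t2 - t1) < 0" by (simp add: algebra_simps)
    then show "a < 0" using t(1) by (simp add: mult_less_0_iff)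
  qed (fact rev)
  have "inj_on (\<lambda>t. trunc n m P (Ed 0 t)) (nbhd0 P t0 e)"
    using aff \<open>a \<noteq> 0\<close> by (intro inj_onI) (auto simp: nbhd0_def)
  then show "\<not> loc_noninj n m P t0" unfolding loc_noninj_def using \<open>0 < e\<close> by blast
qed

lemma local_type_fold:
  assumes fold: "\<And>e. 0 < e \<Longrightarrow> \<exists>t1\<in>nbhd0 P t0 e. \<exists>t2\<in>nbhd0 P t0 e. t1 < t2 \<and>
     trunc n m P (Ed 0 t1) = trunc n m P (Ed 0 t2)"
  shows "\<not> loc_pres n m P t0" "\<not> loc_rev n m P t0" "loc_noninj n m P t0"
proof -
  show "\<not> loc_pres n m P t0"
    unfolding loc_pres_def using fold by (metis less_irrefl)
  show "\<not> loc_rev n m P t0"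
    unfolding loc_rev_def using fold by (metis less_irrefl)
  show "loc_noninj n m P t0"
    unfolding loc_noninj_def inj_on_def using fold by (metis less_irrefl)
qed

text \<open>Serves both directions: the coordinates are \<open>labpar\<close> for a given orbit, and
  the solution of the contraction for a constructed one.\<close>

locale star_points =
  fixes n :: nat and x :: "nat \<Rightarrow> nat \<Rightarrow> real" and N :: "nat \<Rightarrow> nat" and P :: "spt set"
  assumes N_pos: "\<And>r. r < n \<Longrightarrow> 0 < N r"
    and x_mono: "\<And>r s t. r < n \<Longrightarrow> s < t \<Longrightarrow> t < N r \<Longrightarrow> x r s < x r t"
    and P_eq: "P = {Ed r (x r s) | r s. r < n \<and> s < N r}"
begin

lemma x_less_iff: "r < n \<Longrightarrow> s < N r \<Longrightarrow> t < N r \<Longrightarrow> x r s < x r t \<longleftrightarrow> s < t"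
  using x_mono by (metis linorder_neqE_nat order.asym less_irrefl)

lemma x_eq_iff: "r < n \<Longrightarrow> s < N r \<Longrightarrow> t < N r \<Longrightarrow> x r s = x r t \<longleftrightarrow> s = t"
  using x_mono by (metis linorder_neqE_nat less_irrefl)

lemma edge_pts_eq: "r < n \<Longrightarrow> edge_pts P r = x r ` {..<N r}"
  by (auto simp: edge_pts_def P_eq)

lemma sorted_edge_pts:
  assumes "r < n"
  shows "sorted_list_of_set (edge_pts P r) = map (x r) [0..<N r]"
proof (rule strict_sorted_equal)
  show "sorted_wrt (<) (map (x r) [0..<N r])"
    using x_mono[OF assms] by (auto simp: sorted_wrt_iff_nth_less)
  show "set (sorted_list_of_set (edge_pts P r)) = set (map (x r) [0..<N r])"
    using edge_pts_eq[OF assms] by (simp add: atLeast0LessThan)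
qed simp

lemma Ncnt_eq: "r < n \<Longrightarrow> Ncnt P r = N r"
  unfolding Ncnt_def using sorted_edge_pts edge_pts_eq
  by (metis length_map length_upt diff_zero sorted_list_of_set.length_sorted_key_list_of_set)

lemma Nlist_eq: "Nlist n P = map N [0..<n]"
  unfolding Nlist_def using Ncnt_eq by simp

lemma labpar_eq: "r < n \<Longrightarrow> s < N r \<Longrightarrow> labpar P r s = x r s"
  by (simp add: labpar_def sorted_edge_pts)

lemma ptlab_eq: "r < n \<Longrightarrow> s < N r \<Longrightarrow> ptlab P r s = Ed r (x r s)"
  by (simp add: ptlab_def sorted_edge_pts)

lemma Min_edge_pts:
  assumes "r < n" shows "Min (edge_pts P r) = x r 0"
proof (rule Min_eqI)
  fix y assume "y \<in> edge_pts P r"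
  then obtain s where "s < N r" "y = x r s" using edge_pts_eq[OF assms] by auto
  then show "x r 0 \<le> y" using x_less_iff[OF assms, of s 0] N_pos[OF assms] by simp
qed (use edge_pts_eq N_pos assms in auto)

lemma lab_eq:
  assumes "r < n" "s < N r"
  shows "lab P (Ed r (x r s)) = (r, s)"
proof -
  have "{t' \<in> edge_pts P r. t' < x r s} = x r ` {..<s}"
    using edge_pts_eq[OF assms(1)] x_less_iff[OF assms(1)] assms by auto
  moreover have "inj_on (x r) {..<s}"
    using x_eq_iff[OF assms(1)] assms by (auto intro!: inj_onI)
  ultimately show ?thesis by (simp add: lab_def card_image)
qed

end

text \<open>Adds the dynamics. \<open>piece s\<close> is the index of the linear piece of
  \<open>e_0\<close> that contains the point \<open>(0, s)\<close>, and \<open>x_0\<close> is the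
  equation of that branch.\<close>

locale star_coords = rotation n m + star_points n x N P for n m x N P +
  fixes pm :: "nat \<times> nat \<Rightarrow> nat \<times> nat" and piece :: "nat \<Rightarrow> nat"
  assumes x_pos: "\<And>r s. r < n \<Longrightarrow> s < N r \<Longrightarrow> 0 < x r s"
    and x_less_1: "\<And>r s. r < n \<Longrightarrow> s < N r \<Longrightarrow> x r s < 1"
    and pm_in: "\<And>r s. r < n \<Longrightarrow> s < N r \<Longrightarrow> fst (pm (r, s)) < n \<and> snd (pm (r, s)) < N (fst (pm (r, s)))"
    and pm_edge: "\<And>r s. 0 < r \<Longrightarrow> r < n \<Longrightarrow> s < N r \<Longrightarrow> fst (pm (r, s)) = (r + m) mod n"
    and x_edge: "\<And>r s. 0 < r \<Longrightarrow> r < n \<Longrightarrow> s < N r \<Longrightarrow>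
      x (fst (pm (r, s))) (snd (pm (r, s))) = x r s"
    and pm_0: "\<And>s. s < N 0 \<Longrightarrow> fst (pm (0, s)) = (piece s + 1) div 2"
    and x_0: "\<And>s. s < N 0 \<Longrightarrow> (2 * real m + 1) * x 0 s = real (piece s) +
      (if even (piece s) then x (fst (pm (0, s))) (snd (pm (0, s)))
       else 1 - x (fst (pm (0, s))) (snd (pm (0, s))))"
begin

lemma n_pos: "0 < n" using m_small by simp

lemma fstar_coords:
  assumes "r < n" "s < N r"
  shows "fstar n m (Ed r (x r s)) = Ed (fst (pm (r, s))) (x (fst (pm (r, s))) (snd (pm (r, s))))"
proof (cases "r = 0")
  case False
  then show ?thesis using pm_edge[of r s] x_edge[of r s] assms by (simp add: fstar_def)
next
  case True
  let ?y = "x (fst (pm (0, s))) (snd (pm (0, s)))"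
  have y: "0 < ?y" "?y < 1" using x_pos x_less_1 pm_in assms True by blast+
  have "fstar n m (Ed 0 (x 0 s)) = Ed ((piece s + 1) div 2)
     (if even (piece s) then if even (piece s) then ?y else 1 - ?y
      else 1 - (if even (piece s) then ?y else 1 - ?y))"
    by (rule fstar_piece) (use y x_0[of s] assms True in auto)
  then show ?thesis using pm_0[of s] assms True by simp
qed

lemma piP_eq: "piP n m P = (\<lambda>y. if y \<in> labels (map N [0..<n]) then pm y else undefined)"
proof
  fix y :: "nat \<times> nat"
  obtain r s where y: "y = (r, s)" by (cases y)
  show "piP n m P y = (if y \<in> labels (map N [0..<n]) then pm y else undefined)"
  proof (cases "r < n \<and> s < N r")
    case True
    then have "piP n m P y = lab P (fstar n m (ptlab P r s))"
      by (simp add: piP_def Nlist_eq labels_map y)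
    then show ?thesis
      using True pm_in[of r s] by (simp add: ptlab_eq fstar_coords lab_eq labels_map y)
  qed (auto simp: piP_def Nlist_eq labels_map y)
qed

lemma fstar_near:
  assumes "s < N 0"
  obtains e where "0 < e"
    "\<And>t. \<bar>t - x 0 s\<bar> < e \<Longrightarrow> fstar n m (Ed 0 t) = Ed (fst (pm (0, s))) (x (fst (pm (0, s))) (snd (pm (0, s))) +
      (if even (piece s) then 2 * real m + 1 else - (2 * real m + 1)) * (t - x 0 s))"
proof
  let ?y = "x (fst (pm (0, s))) (snd (pm (0, s)))" and ?c = "2 * real m + 1"
  \<comment> \<open>The branch has slope \<open>?c\<close> in absolute value, so within this radius
    the image parameter stays in the open unit interval and \<open>t\<close> stays in the same
    piece.\<close>
  let ?e = "min ?y (1 - ?y) / ?c"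
  have y: "0 < ?y" "?y < 1" using x_pos x_less_1 pm_in assms n_pos by blast+
  show "0 < ?e" using y by simp
  fix t assume t: "\<bar>t - x 0 s\<bar> < ?e"
  define z where "z = ?c * (t - x 0 s)"
  have "\<bar>z\<bar> = ?c * \<bar>t - x 0 s\<bar>" unfolding z_def by (simp add: abs_mult)
  also have "\<dots> < min ?y (1 - ?y)" using t by (simp add: pos_less_divide_eq mult.commute)
  finally have z: "\<bar>z\<bar> < ?y" "\<bar>z\<bar> < 1 - ?y" by auto
  define w where "w = (if even (piece s) then ?y else 1 - ?y) + z"
  have "0 < w" "w < 1" using z unfolding w_def by auto
  moreover have "?c * t = real (piece s) + w"
    using x_0[OF assms] unfolding w_def z_def by (simp add: algebra_simps)
  ultimately have "fstar n m (Ed 0 t) = Ed ((piece s + 1) div 2) (if even (piece s) then w else 1 - w)"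
    by (rule fstar_piece)
  then show "fstar n m (Ed 0 t) = Ed (fst (pm (0, s))) (?y + (if even (piece s) then ?c else - ?c) * (t - x 0 s))"
    using pm_0[OF assms] unfolding w_def z_def by (auto simp: algebra_simps)
qed

text \<open>The image lies strictly above the first point of its edge, so the retraction is inactive
  nearby and the slope of the piece decides.\<close>

lemma local_type_inner:
  assumes "s < N 0" "0 < snd (pm (0, s))"
  shows "loc_pres n m P (labpar P 0 s) \<longleftrightarrow> even (piece s)"
    "loc_rev n m P (labpar P 0 s) \<longleftrightarrow> odd (piece s)"
    "\<not> loc_noninj n m P (labpar P 0 s)"
proof -
  let ?r = "fst (pm (0, s))" let ?y = "x ?r (snd (pm (0, s)))"
  let ?c = "2 * real m + 1"
  let ?a = "if even (piece s) then ?c else - ?c"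
  obtain e where e: "0 < e"
    "\<And>t. \<bar>t - x 0 s\<bar> < e \<Longrightarrow> fstar n m (Ed 0 t) = Ed ?r (?y + ?a * (t - x 0 s))"
    using fstar_near[OF assms(1)] by metis
  have r: "?r < n" "snd (pm (0, s)) < N ?r" using pm_in assms(1) n_pos by blast+
  have gt: "x ?r 0 < ?y" using x_mono r assms(2) by blast
  define e' where "e' = min e ((?y - x ?r 0) / ?c)"
  have e': "0 < e'" unfolding e'_def using e(1) gt by simp
  have aff: "trunc n m P (Ed 0 t) = Ed ?r (?y + ?a * (t - x 0 s))" if "\<bar>t - x 0 s\<bar> < e'" for t
  proof -
    have "\<bar>?a * (t - x 0 s)\<bar> = ?c * \<bar>t - x 0 s\<bar>" by (simp add: abs_mult)
    also have "\<dots> < ?y - x ?r 0"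
      using that unfolding e'_def by (simp add: pos_less_divide_eq mult.commute)
    finally have "x ?r 0 < ?y + ?a * (t - x 0 s)" by linarith
    then show ?thesis
      using e(2)[of t] that unfolding e'_def trunc_def retr_def
      by (simp add: Min_edge_pts[OF r(1)])
  qed
  have t0: "labpar P 0 s = x 0 s" "Min (edge_pts P 0) \<le> x 0 s" "x 0 s < 1"
    using labpar_eq Min_edge_pts x_less_iff[of 0 s 0] x_less_1 N_pos assms(1) n_pos by (auto simp: not_less[symmetric])
  have a: "?a \<noteq> 0" by simp
  have "loc_pres n m P (x 0 s) \<longleftrightarrow> 0 < ?a" "loc_rev n m P (x 0 s) \<longleftrightarrow> ?a < 0"
    "\<not> loc_noninj n m P (x 0 s)"
    by (rule local_type_affine[OF t0(2,3) e' a aff]; assumption)+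
  then show "loc_pres n m P (labpar P 0 s) \<longleftrightarrow> even (piece s)"
    "loc_rev n m P (labpar P 0 s) \<longleftrightarrow> odd (piece s)"
    "\<not> loc_noninj n m P (labpar P 0 s)"
    unfolding t0(1) by (auto split: if_splits)
qed

text \<open>The image is the first point of its edge, so the retraction collapses one side of the
  neighbourhood: the left one on an even piece, the right one on an odd piece. As
  \<open>0 < s\<close>, both sides lie in the span of \<open>P\<close>.\<close>

lemma local_type_min:
  assumes "0 < s" "s < N 0" "snd (pm (0, s)) = 0"
  shows "\<not> loc_pres n m P (labpar P 0 s)" "\<not> loc_rev n m P (labpar P 0 s)"
    "loc_noninj n m P (labpar P 0 s)"
proof -
  let ?r = "fst (pm (0, s))" let ?y = "x ?r 0"
  let ?c = "2 * real m + 1"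
  let ?a = "if even (piece s) then ?c else - ?c"
  obtain e where e: "0 < e"
    "\<And>t. \<bar>t - x 0 s\<bar> < e \<Longrightarrow> fstar n m (Ed 0 t) = Ed ?r (?y + ?a * (t - x 0 s))"
    using fstar_near[OF assms(2)] unfolding assms(3) by metis
  have r: "?r < n" using pm_in assms(2) n_pos by blast
  have ne: "edge_pts P ?r \<noteq> {}" using edge_pts_eq[OF r] N_pos[OF r] by auto
  have t0: "labpar P 0 s = x 0 s" "Min (edge_pts P 0) < x 0 s" "x 0 s < 1"
    using labpar_eq Min_edge_pts x_mono[of 0 0 s] x_less_1 assms n_pos by auto
  have const: "trunc n m P (Ed 0 t) = Ed ?r ?y" if "\<bar>t - x 0 s\<bar> < e" "?a * (t - x 0 s) \<le> 0" for t
    using e(2)[OF that(1)] that(2) ne unfolding trunc_def retr_def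
    by (auto simp: Min_edge_pts[OF r])
  have "\<exists>t1\<in>nbhd0 P (x 0 s) e'. \<exists>t2\<in>nbhd0 P (x 0 s) e'. t1 < t2 \<and>
     trunc n m P (Ed 0 t1) = trunc n m P (Ed 0 t2)" if e': "0 < e'" for e'
  proof -
    define d where "d = min (min e e') (min (1 - x 0 s) (x 0 s - Min (edge_pts P 0))) / 2"
    have d: "0 < d" "d < e" "d < e'" "d < 1 - x 0 s" "d < x 0 s - Min (edge_pts P 0)"
      using e(1) e' t0 unfolding d_def by (auto simp: min_def)
    have nb: "x 0 s - d \<in> nbhd0 P (x 0 s) e'" "x 0 s \<in> nbhd0 P (x 0 s) e'"
      "x 0 s + d \<in> nbhd0 P (x 0 s) e'"
      using d t0 unfolding nbhd0_def by auto
    have mid: "trunc n m P (Ed 0 (x 0 s)) = Ed ?r ?y" using const[of "x 0 s"] e(1) by simp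
    show ?thesis
    proof (cases "even (piece s)")
      case True
      then have "trunc n m P (Ed 0 (x 0 s - d)) = Ed ?r ?y"
        using const[of "x 0 s - d"] d by (simp add: mult_le_0_iff)
      then show ?thesis using nb mid d(1) by (intro bexI[of _ "x 0 s - d"] bexI[of _ "x 0 s"]) auto
    next
      case False
      then have "trunc n m P (Ed 0 (x 0 s + d)) = Ed ?r ?y"
        using const[of "x 0 s + d"] d by (simp add: mult_le_0_iff)
      then show ?thesis using nb mid d(1) by (intro bexI[of _ "x 0 s"] bexI[of _ "x 0 s + d"]) auto
    qed
  qed
  note fold = this
  show "\<not> loc_pres n m P (labpar P 0 s)" "\<not> loc_rev n m P (labpar P 0 s)"
    "loc_noninj n m P (labpar P 0 s)"
    unfolding t0(1) by (rule local_type_fold, erule fold)+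
qed

end

section \<open>Coordinates of a star orbit\<close>

lemma valid_fstar:
  assumes "0 < m" "m < n" "valid_pt n y"
  shows "valid_pt n (fstar n m y)"
proof (cases y)
  case Ctr
  then show ?thesis by (simp add: fstar_def valid_pt_def)
next
  case (Ed r t)
  then have rt: "r < n" "0 \<le> t" "t < 1" using assms(3) by (auto simp: valid_pt_def)
  show ?thesis
  proof (cases "r = 0")
    case False
    then show ?thesis using Ed rt assms by (simp add: fstar_def valid_pt_def)
  next
    case True
    define u where "u = (2 * real m + 1) * t"
    define j where "j = nat \<lfloor>u\<rfloor>"
    have u: "0 \<le> u" "u < 2 * real m + 1" using rt by (auto simp: u_def mult_less_cancel_left2)
    have j: "real j \<le> u" "u < real j + 1" using u unfolding j_def by linarith+
    have "real j < real (2 * m + 1)" using u j by simp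
    then have "j < 2 * m + 1" by linarith
    then have "(j + 1) div 2 < n" "j div 2 < n" using assms by linarith+
    then show ?thesis unfolding Ed True fstar_def valid_pt_def
      using j u by (auto simp: Let_def u_def[symmetric] j_def[symmetric])
  qed
qed

context rotation
begin

context
  fixes P :: "spt set"
  assumes orbit: "star_orbit n m P"
begin

lemma star_orbit_cyclic: "cyclic_map (fstar n m) P"
proof -
  obtain z k where "0 < k" "(fstar n m ^^ k) z = z" "P = {(fstar n m ^^ j) z | j. j < k}"
    using orbit unfolding star_orbit_def by blast
  then show ?thesis by (rule periodic_orbit_cyclic_map)
qed

text \<open>The centre is fixed, and initial points go to initial points. An orbit through the
  centre would be \<open>{Ctr}\<close>; one through an initial point would consist of such points,
  hence contain the fixed point \<open>Ed 0 0\<close> and miss the edge 1.\<close>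

lemma star_orbit_interior:
  assumes "y \<in> P"
  shows "\<exists>r t. y = Ed r t \<and> r < n \<and> 0 < t \<and> t < 1"
proof -
  interpret O: cyclic_map "fstar n m" P by (rule star_orbit_cyclic)
  have edges: "edge_pts P r \<noteq> {}" if "r < n" for r using orbit that unfolding star_orbit_def by blast
  have "Ctr \<notin> P"
  proof
    assume "Ctr \<in> P"
    then have "{Ctr} = P" by (intro O.invariant_subset[of _ Ctr]) (auto simp: fstar_def)
    then show False using orbit unfolding star_orbit_def by blast
  qed
  moreover have "Ed r 0 \<notin> P" for r
  proof
    assume r: "Ed r 0 \<in> P"
    have "{z \<in> P. \<exists>r. z = Ed r 0} = P"
    proof (rule O.invariant_subset)
      show "Ed r 0 \<in> {z \<in> P. \<exists>r. z = Ed r 0}" using r by blast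
      fix z assume z: "z \<in> {z \<in> P. \<exists>r. z = Ed r 0}"
      then have "\<exists>r. fstar n m z = Ed r 0" by (auto simp: fstar_def Let_def)
      then show "fstar n m z \<in> {z \<in> P. \<exists>r. z = Ed r 0}" using z O.closed by blast
    qed blast
    then have "\<And>z. z \<in> P \<Longrightarrow> \<exists>r. z = Ed r 0" by blast
    moreover obtain t where "Ed 0 t \<in> P" using edges[of 0] m_small by (auto simp: edge_pts_def)
    ultimately have "Ed 0 0 \<in> P" by (metis spt.inject)
    then have "{Ed 0 0} = P" by (intro O.invariant_subset[of _ "Ed 0 0"]) (auto simp: fstar_def)
    then have "edge_pts P 1 = {}" by (auto simp: edge_pts_def)
    then show False using edges[of 1] m_small m_gt_1 by simp
  qed
  moreover have "valid_pt n y"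
  proof -
    obtain z k where z: "valid_pt n z" "0 < k" "P = {(fstar n m ^^ j) z | j. j < k}"
      using orbit unfolding star_orbit_def by blast
    then obtain j where "y = (fstar n m ^^ j) z" using assms by blast
    moreover have "valid_pt n ((fstar n m ^^ j) z)" for j
      by (induction j) (use z valid_fstar m_gt_1 m_small in auto)
    ultimately show ?thesis by simp
  qed
  ultimately show ?thesis using assms
    by (cases y) (auto simp: valid_pt_def less_le)
qed

lemma finite_edge_pts: "finite (edge_pts P r)"
proof -
  interpret O: cyclic_map "fstar n m" P by (rule star_orbit_cyclic)
  have "edge_pts P r = Ed r -` P" by (auto simp: edge_pts_def)
  then show ?thesis using O.finite_carrier by (simp add: finite_vimageI inj_def)
qed

lemma star_orbit_points: "star_points n (labpar P) (Ncnt P) P"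
proof
  fix r assume r: "r < n"
  show "0 < Ncnt P r" 
    using finite_edge_pts orbit r by (simp add: Ncnt_def card_gt_0_iff star_orbit_def)
  fix s t assume "s < t" "t < Ncnt P r"
  then show "labpar P r s < labpar P r t"
    unfolding labpar_def Ncnt_def by (intro sorted_wrt_nth_less[of "(<)"]) auto
next
  have edge: "edge_pts P r = labpar P r ` {..<Ncnt P r}" for r
  proof -
    have "edge_pts P r = set (sorted_list_of_set (edge_pts P r))" using finite_edge_pts by simp
    also have "\<dots> = labpar P r ` {..<Ncnt P r}"
      unfolding set_conv_nth labpar_def Ncnt_def by auto
    finally show ?thesis .
  qed
  show "P = {Ed r (labpar P r s) | r s. r < n \<and> s < Ncnt P r}"
  proof (intro equalityI subsetI)
    fix y assume y: "y \<in> P"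
    then obtain r t where rt: "y = Ed r t" "r < n" using star_orbit_interior by blast
    then have "t \<in> labpar P r ` {..<Ncnt P r}" using y edge[of r] by (auto simp: edge_pts_def)
    then show "y \<in> {Ed r (labpar P r s) | r s. r < n \<and> s < Ncnt P r}" using rt by auto
  next
    fix y assume "y \<in> {Ed r (labpar P r s) | r s. r < n \<and> s < Ncnt P r}"
    then obtain r s where "y = Ed r (labpar P r s)" "s < Ncnt P r" by auto
    moreover then have "labpar P r s \<in> edge_pts P r" using edge[of r] by auto
    ultimately show "y \<in> P" by (simp add: edge_pts_def)
  qed
qed

lemma piP_star_orbit:
  assumes "r < n" "s < Ncnt P r"
  shows "fst (piP n m P (r, s)) < n" "snd (piP n m P (r, s)) < Ncnt P (fst (piP n m P (r, s)))"
    "fstar n m (Ed r (labpar P r s)) =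
      Ed (fst (piP n m P (r, s))) (labpar P (fst (piP n m P (r, s))) (snd (piP n m P (r, s))))"
proof -
  interpret star_points n "labpar P" "Ncnt P" P by (rule star_orbit_points)
  interpret O: cyclic_map "fstar n m" P by (rule star_orbit_cyclic)
  have "Ed r (labpar P r s) \<in> P" using P_eq assms by blast
  then have "fstar n m (Ed r (labpar P r s)) \<in> P" by (rule O.closed)
  then obtain r' s' where rs: "fstar n m (Ed r (labpar P r s)) = Ed r' (labpar P r' s')"
    "r' < n" "s' < Ncnt P r'" using P_eq by blast
  have "piP n m P (r, s) = (r', s')"
    using assms rs unfolding piP_def Nlist_eq by (simp add: labels_map ptlab_eq lab_eq)
  then show "fst (piP n m P (r, s)) < n" "snd (piP n m P (r, s)) < Ncnt P (fst (piP n m P (r, s)))"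
    "fstar n m (Ed r (labpar P r s)) =
      Ed (fst (piP n m P (r, s))) (labpar P (fst (piP n m P (r, s))) (snd (piP n m P (r, s))))"
    using rs by simp_all
qed

lemma star_orbit_coords:
  "star_coords n m (labpar P) (Ncnt P) P (piP n m P) (\<lambda>s. nat \<lfloor>(2 * real m + 1) * labpar P 0 s\<rfloor>)"
proof -
  interpret star_points n "labpar P" "Ncnt P" P by (rule star_orbit_points)
  have interior: "0 < labpar P r s" "labpar P r s < 1" if "r < n" "s < Ncnt P r" for r s
  proof -
    have "Ed r (labpar P r s) \<in> P" using P_eq that by blast
    then show "0 < labpar P r s" "labpar P r s < 1" using star_orbit_interior by blast+
  qed
  have e0: "fst (piP n m P (0, s)) = (nat \<lfloor>(2 * real m + 1) * labpar P 0 s\<rfloor> + 1) div 2 \<and>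
    (2 * real m + 1) * labpar P 0 s = real (nat \<lfloor>(2 * real m + 1) * labpar P 0 s\<rfloor>) +
      (if even (nat \<lfloor>(2 * real m + 1) * labpar P 0 s\<rfloor>) then labpar P (fst (piP n m P (0, s))) (snd (piP n m P (0, s)))
       else 1 - labpar P (fst (piP n m P (0, s))) (snd (piP n m P (0, s))))"
    if s: "s < Ncnt P 0" for s
  proof -
    let ?t = "labpar P 0 s" and ?y = "piP n m P (0, s)"
    define u where "u = (2 * real m + 1) * ?t"
    define j where "j = nat \<lfloor>u\<rfloor>"
    define w where "w = u - real j"
    have n: "0 < n" using m_small by simp
    note f = piP_star_orbit[OF n s]
    have pos: "0 < u" using interior(1)[OF n s] by (simp add: u_def)
    have w: "0 \<le> w" "w < 1" using pos unfolding w_def j_def by linarith+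
    \<comment> \<open>A point on the border of two pieces is sent to the centre or to an initial
      point, which an orbit avoids.\<close>
    have "w \<noteq> 0"
    proof
      assume w0: "w = 0"
      then have "j \<noteq> 0" using pos by (auto simp: w_def)
      then have "fstar n m (Ed 0 ?t) = (if odd j then Ctr else Ed (j div 2) 0)"
        using w0 unfolding w_def j_def u_def by (auto simp: fstar_def Let_def)
      then have "labpar P (fst ?y) (snd ?y) = 0" using f(3) by (auto split: if_splits)
      then show False using interior(1)[OF f(1,2)] by simp
    qed
    then have fw: "fstar n m (Ed 0 ?t) = Ed ((j + 1) div 2) (if even j then w else 1 - w)"
      by (intro fstar_piece) (use w in \<open>auto simp: w_def u_def\<close>)
    have y: "fst ?y = (j + 1) div 2" "labpar P (fst ?y) (snd ?y) = (if even j then w else 1 - w)"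
      using f(3) unfolding fw spt.inject by metis+
    show ?thesis unfolding u_def[symmetric] j_def[symmetric] y(2) using y(1) by (simp add: w_def)
  qed
  show ?thesis
  proof
    fix r s assume r: "0 < r" "r < n" and s: "s < Ncnt P r"
    show "fst (piP n m P (r, s)) = (r + m) mod n"
      "labpar P (fst (piP n m P (r, s))) (snd (piP n m P (r, s))) = labpar P r s"
      using piP_star_orbit(3)[OF r(2) s] r(1) by (simp_all add: fstar_def)
  qed (use interior piP_star_orbit e0 in blast)+
qed

lemma star_orbit_piP_min:
  assumes "0 < r" "r < n"
  shows "piP n m P (r, 0) = ((r + m) mod n, 0)"
proof -
  interpret star_points n "labpar P" "Ncnt P" P by (rule star_orbit_points)
  have "fstar n m (ptlab P r 0) = ptlab P ((r + m) mod n) 0"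
    using orbit assms unfolding star_orbit_def by blast
  moreover have "(r + m) mod n < n" using assms by simp
  ultimately show ?thesis
    using assms N_pos unfolding piP_def Nlist_eq by (simp add: labels_map ptlab_eq lab_eq)
qed

text \<open>Labelling is a bijection conjugating \<open>fstar\<close> on \<open>P\<close> to
  \<open>piP\<close>, so the single cycle is inherited.\<close>

lemma star_orbit_piP_cyclic: "cyclic_map (piP n m P) (labels (map (Ncnt P) [0..<n]))"
proof -
  interpret star_points n "labpar P" "Ncnt P" P by (rule star_orbit_points)
  interpret O: cyclic_map "fstar n m" P by (rule star_orbit_cyclic)
  let ?L = "labels (map (Ncnt P) [0..<n])"
  let ?pt = "\<lambda>y. Ed (fst y) (labpar P (fst y) (snd y))"
  have pt_in: "?pt y \<in> P" if "y \<in> ?L" for y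
    using that unfolding labels_map by (subst P_eq) auto
  have pt_lab: "lab P (?pt y) = y" if "y \<in> ?L" for y
    using that unfolding labels_map by (auto simp: lab_eq)
  have closed: "piP n m P y \<in> ?L" if "y \<in> ?L" for y
    using that piP_star_orbit(1,2)[of "fst y" "snd y"] unfolding labels_map by (auto simp: mem_Sigma_iff[of "fst (piP n m P y)" "snd (piP n m P y)", simplified])
  have pow: "(piP n m P ^^ j) y \<in> ?L \<and> ?pt ((piP n m P ^^ j) y) = (fstar n m ^^ j) (?pt y)"
    if "y \<in> ?L" for y j
  proof (induction j)
    case (Suc j)
    let ?z = "(piP n m P ^^ j) y"
    have "fst ?z < n" "snd ?z < Ncnt P (fst ?z)" using Suc unfolding labels_map by auto
    then show ?case using piP_star_orbit(3)[of "fst ?z" "snd ?z"] Suc closed[of ?z] by simp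
  qed (use that in simp)
  show ?thesis
  proof
    show "finite ?L" by (simp add: labels_map)
    have "(0, 0) \<in> ?L" using N_pos[of 0] m_small by (simp add: labels_map)
    then show "?L \<noteq> {}" by blast
  next
    fix y z assume yz: "y \<in> ?L" "z \<in> ?L"
    obtain j where "(fstar n m ^^ j) (?pt y) = ?pt z" using O.reachable pt_in yz by blast
    then have "?pt ((piP n m P ^^ j) y) = ?pt z" using pow[OF yz(1)] by simp
    then have "(piP n m P ^^ j) y = z" using pt_lab pow[OF yz(1), of j] yz(2) by metis
    then show "\<exists>j. (piP n m P ^^ j) y = z" by blast
  qed (fact closed)
qed

end

end

section \<open>Data of orbits satisfying the train track conditions\<close>

context rotation_pair
begin

definition Nexp :: "nat \<Rightarrow> nat \<Rightarrow> nat \<Rightarrow> nat" where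
  "Nexp p q r = (if ps r < ps l then 1 else if ps r < ps k then q + 1 - p else q + 1)"

definition pexp :: "nat \<Rightarrow> nat \<Rightarrow> nat \<times> nat \<Rightarrow> nat \<times> nat" where
  "pexp p q y = (let r = fst y; s = snd y in
     if r = 0 \<and> s < p then (k, q - p + s)
     else if r = 0 \<and> s = p then (l, q - p)
     else if r = 0 \<and> p + 1 \<le> s \<and> s < q then (l, s - p)
     else if r = 0 \<and> s = q then (m, 0)
     else if r = k + n - m \<and> s = q - p then (k, q)
     else ((r + m) mod n, s))"

text \<open>The prescribed data in terms of positions and for arbitrary \<open>p\<close> and
  \<open>q\<close>: coprimality is a conclusion in one direction and a hypothesis in the
  other.\<close>

definition Dpq :: "nat \<Rightarrow> nat \<Rightarrow> odata" where
  "Dpq p q = (map (Nexp p q) [0..<n],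
     \<lambda>y. if y \<in> labels (map (Nexp p q) [0..<n]) then pexp p q y else undefined,
     {p}, {0..<q} - {p}, {q})"

lemma succ_eq_iff:
  assumes "r < n" "r' < m"
  shows "(r + m) mod n = r' \<longleftrightarrow> r = r' + n - m"
  using mod_step_cases[OF assms(1)] assms m_small by auto

lemma succ_eq_m_iff: "r < n \<Longrightarrow> (r + m) mod n = m \<longleftrightarrow> r = 0"
  using mod_step_cases[of r] m_small by auto

lemma succ_less: "(r + m) mod n < n" using m_small by simp

end

text \<open>The combinatorial remains of an orbit. Order on \<open>e_0\<close> is recorded for even
  pieces only; that a single label below \<open>q\<close> lies in an odd piece is extracted later
  from the colours.\<close>

locale tt_orbit = rotation_pair n m k l + cyclic_map pm "labels (map N [0..<n])"
  for n m k l :: nat and pm :: "nat \<times> nat \<Rightarrow> nat \<times> nat" and N :: "nat \<Rightarrow> nat" +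
  fixes piece :: "nat \<Rightarrow> nat" and A B C :: "nat set"
  assumes N_pos: "\<And>r. r < n \<Longrightarrow> 0 < N r"
    and pm_edge: "\<And>r s. 0 < r \<Longrightarrow> r < n \<Longrightarrow> s < N r \<Longrightarrow> fst (pm (r, s)) = (r + m) mod n"
    and pm_edge_mono: "\<And>r s t. 0 < r \<Longrightarrow> r < n \<Longrightarrow> s < t \<Longrightarrow> t < N r \<Longrightarrow> snd (pm (r, s)) < snd (pm (r, t))"
    and pm_min: "\<And>r. 0 < r \<Longrightarrow> r < n \<Longrightarrow> pm (r, 0) = ((r + m) mod n, 0)"
    and pm_0: "\<And>s. s < N 0 \<Longrightarrow> fst (pm (0, s)) = (piece s + 1) div 2"
    and piece_le: "\<And>s. s < N 0 \<Longrightarrow> piece s \<le> 2 * m"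
    and piece_mono: "\<And>s t. s < t \<Longrightarrow> t < N 0 \<Longrightarrow> piece s \<le> piece t"
    and pm_0_mono: "\<And>s t. s < t \<Longrightarrow> t < N 0 \<Longrightarrow> piece s = piece t \<Longrightarrow> even (piece s) \<Longrightarrow>
      snd (pm (0, s)) < snd (pm (0, t))"
    and pm_undefined: "\<And>y. y \<notin> labels (map N [0..<n]) \<Longrightarrow> pm y = undefined"
    and ABC_bounded: "A \<subseteq> {..<N 0}" "B \<subseteq> {..<N 0}" "C \<subseteq> {..<N 0}"
    and ABC_inner: "\<And>s. s < N 0 \<Longrightarrow> 0 < snd (pm (0, s)) \<Longrightarrow>
      (s \<in> A \<longleftrightarrow> odd (piece s)) \<and> (s \<in> B \<longleftrightarrow> even (piece s)) \<and> s \<notin> C"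
    and ABC_min: "\<And>s. 0 < s \<Longrightarrow> s < N 0 \<Longrightarrow> snd (pm (0, s)) = 0 \<Longrightarrow> s \<notin> A \<and> s \<notin> B \<and> s \<in> C"
    and start_edge: "fst (pm (0, 0)) = k" and start_B: "0 \<in> B"
    and TT: "TTcond n m k GB (map N [0..<n], pm, A, B, C)"
begin

abbreviation "L \<equiv> labels (map N [0..<n])"

section \<open>Targets of the points of \<open>e_0\<close> and the number of points on each
  edge\<close>

lemma L_iff: "(r, s) \<in> L \<longleftrightarrow> r < n \<and> s < N r" by (simp add: labels_map)

lemma pm_in: "r < n \<Longrightarrow> s < N r \<Longrightarrow> fst (pm (r, s)) < n \<and> snd (pm (r, s)) < N (fst (pm (r, s)))"
  using closed[of "(r, s)"] L_iff by (metis prod.collapse)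

lemma pm_inj: "(r, s) \<in> L \<Longrightarrow> (r', s') \<in> L \<Longrightarrow> pm (r, s) = pm (r', s') \<Longrightarrow> r = r' \<and> s = s'"
  using inj by (meson inj_onD prod.inject)

lemma pm_onto:
  assumes "r < n" "s < N r"
  obtains r' s' where "r' < n" "s' < N r'" "pm (r', s') = (r, s)"
proof -
  have "(r, s) \<in> pm ` L" using surj L_iff assms by blast
  then show ?thesis using that L_iff by (metis imageE surj_pair)
qed

lemma n_pos: "0 < n" using m_small by simp

text \<open>On an edge \<open>r < m\<close> the label \<open>(r, 0)\<close> is already the image of
  the first label of the preceding edge, which is not \<open>e_0\<close>; injectivity leaves only
  \<open>m\<close>.\<close>

lemma snd_eq_0_imp_m:
  assumes "s < N 0" "snd (pm (0, s)) = 0"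
  shows "fst (pm (0, s)) = m"
proof (rule ccontr)
  assume ne: "fst (pm (0, s)) \<noteq> m"
  have "fst (pm (0, s)) \<le> m" using pm_0[OF assms(1)] piece_le[OF assms(1)] by linarith
  then have lt: "fst (pm (0, s)) < m" using ne by simp
  let ?r = "fst (pm (0, s)) + n - m"
  have r: "?r < n" "?r \<noteq> 0" "(?r + m) mod n = fst (pm (0, s))" using prev_edge[OF lt] by auto
  have "pm (?r, 0) = pm (0, s)" using pm_min[of ?r] r assms(2) by (metis gr0I prod.collapse)
  then show False using pm_inj[of ?r 0 0 s] r N_pos n_pos assms(1) L_iff by blast
qed

lemma N_mono_edge:
  assumes "0 < r" "r < n"
  shows "N r \<le> N ((r + m) mod n)"
proof -
  have "inj_on (\<lambda>s. snd (pm (r, s))) {..<N r}"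
    using pm_edge_mono[OF assms] by (intro inj_onI) (metis lessThan_iff linorder_neqE_nat less_irrefl)
  moreover have "(\<lambda>s. snd (pm (r, s))) ` {..<N r} \<subseteq> {..<N ((r + m) mod n)}"
    using pm_in[OF assms(2)] pm_edge[OF assms] by auto
  ultimately show ?thesis by (metis card_inj_on_le card_lessThan finite_lessThan)
qed

text \<open>Condition (b) at \<open>l\<close> gives one point on the predecessor of
  \<open>l\<close>, and counts do not decrease along the list, so all earlier edges carry one point
  as well.\<close>

lemma N_R:
  assumes "r < n" "ps r < ps l"
  shows "N r = 1"
proof -
  have lr: "l + n - m < n" "ps l = Suc (ps (l + n - m))" using prev_edge[OF l_less_m] by auto
  have "N (l + n - m) = 1"
    using TT lr(1) k_less_l l_less_m unfolding TTcond_def by auto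
  moreover have "N (E i) \<le> N (E j)" if "i \<le> j" "j \<le> ps (l + n - m)" for i j
    using that
  proof (induction j rule: dec_induct)
    case (step j)
    have j: "Suc j < n" using step ps_less[OF lr(1)] by linarith
    then have "E j \<noteq> 0" using E_eq_0_iff[of j] by auto
    then have "N (E j) \<le> N (E (Suc j))" using N_mono_edge[of "E j"] E_less by (simp add: E_Suc)
    then show ?case using step by simp
  qed simp
  ultimately have "N (E (ps r)) \<le> 1" using lr assms(2) E_ps[OF lr(1)]
    by (metis less_Suc_eq_le order_refl)
  then show ?thesis using N_pos[OF assms(1)] E_ps[OF assms(1)] by simp
qed

lemma piece_start: "piece 0 = 2 * k"
proof -
  have s0: "0 < N 0" using N_pos n_pos by blast
  have "snd (pm (0, 0)) \<noteq> 0" using snd_eq_0_imp_m[OF s0] start_edge kl_less by auto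
  then have "even (piece 0)" using ABC_inner[OF s0] start_B by blast
  then show ?thesis using pm_0[OF s0] start_edge by (elim evenE) simp
qed

lemma piece_ge: "s < N 0 \<Longrightarrow> 2 * k \<le> piece s"
  using piece_mono[of 0 s] piece_start by (cases "s = 0") auto

text \<open>Any other edge between \<open>k\<close> and \<open>m\<close> is listed before
  \<open>l\<close> and carries one point, which already comes from the preceding edge.\<close>

lemma targets:
  assumes "s < N 0"
  shows "fst (pm (0, s)) \<in> {k, l, m}"
proof (rule ccontr)
  let ?r = "fst (pm (0, s))"
  assume ne: "?r \<notin> {k, l, m}"
  have "k \<le> ?r" "?r \<le> m" using pm_0[OF assms] piece_ge[OF assms] piece_le[OF assms] by linarith+
  then have r: "k < ?r" "?r < m" "?r \<noteq> l" using ne by auto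
  then have "N ?r = 1" using N_R[of ?r] ps_between[of ?r] kl_less by simp
  then have "snd (pm (0, s)) = 0" using pm_in[of 0 s] assms n_pos by simp
  then show False using snd_eq_0_imp_m[OF assms] r by simp
qed

lemma N_m: "N m = 1" using N_R[of m] ps_m ps_l_pos kl_less by simp

lemma target_m: "s < N 0 \<Longrightarrow> fst (pm (0, s)) = m \<Longrightarrow> pm (0, s) = (m, 0)"
  using pm_in[of 0 s] N_m n_pos by (metis less_one prod.collapse)

text \<open>The parameters read off from the orbit: \<open>q\<close> is the last label on
  \<open>e_0\<close>, and since targets are nondecreasing, \<open>p\<close> counts the labels sent
  to \<open>k\<close>.\<close>

definition q where "q = N 0 - 1"
definition p where "p = (LEAST s. fst (pm (0, s)) \<noteq> k)"

lemma N_0: "N 0 = Suc q" using N_pos[OF n_pos] by (simp add: q_def)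

lemma target_mono: "s \<le> t \<Longrightarrow> t < N 0 \<Longrightarrow> fst (pm (0, s)) \<le> fst (pm (0, t))"
  using piece_mono[of s t] pm_0[of s] pm_0[of t] by (cases "s = t") (auto intro: div_le_mono)

text \<open>The only edge mapped to \<open>m\<close> by the rotation is 0, so \<open>(m, 0)\<close>
  is hit from \<open>e_0\<close>; by monotonicity of the targets the last label goes there
  too.\<close>

lemma pm_q: "pm (0, q) = (m, 0)"
proof -
  obtain r z where z: "r < n" "z < N r" "pm (r, z) = (m, 0)"
    using pm_onto[of m 0] N_m kl_less by (metis less_one)
  have "r = 0" using pm_edge[of r z] succ_eq_m_iff[of r] z by (metis fst_conv gr0I)
  then have z0: "z < N 0" "pm (0, z) = (m, 0)" using z by auto
  have "z \<le> q" using z0 N_0 by simp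
  then have "m \<le> fst (pm (0, q))" using target_mono[of z q] N_0 z0(2) by simp
  then have "fst (pm (0, q)) = m" using targets[of q] N_0 kl_less l_less_m by auto
  then show ?thesis using target_m[of q] N_0 by simp
qed

lemma pm_less_q:
  assumes "s < q"
  shows "fst (pm (0, s)) \<noteq> m" "0 < snd (pm (0, s))"
proof -
  show "fst (pm (0, s)) \<noteq> m"
  proof
    assume "fst (pm (0, s)) = m"
    then have "pm (0, s) = pm (0, q)" using target_m[of s] pm_q assms N_0 by simp
    then show False using pm_inj[of 0 s 0 q] L_iff assms N_0 n_pos by simp
  qed
  then show "0 < snd (pm (0, s))" using snd_eq_0_imp_m[of s] assms N_0 by fastforce
qed

lemma p_le_q: "p \<le> q"
  unfolding p_def using pm_q kl_less by (intro Least_le) auto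

lemma target_p: "fst (pm (0, p)) \<noteq> k"
proof -
  have "fst (pm (0, q)) \<noteq> k" using pm_q kl_less by simp
  then show ?thesis unfolding p_def by (rule LeastI)
qed

lemma p_pos: "0 < p"
  using target_p start_edge by (metis gr0I)

lemma target_less_p: "s < p \<Longrightarrow> fst (pm (0, s)) = k"
  unfolding p_def using not_less_Least by blast

lemma target_ge_p:
  assumes "p \<le> s" "s < q" shows "fst (pm (0, s)) = l"
proof -
  have s: "s < N 0" "p < N 0" using assms N_0 by auto
  have "fst (pm (0, p)) \<le> fst (pm (0, s))" using target_mono[OF assms(1) s(1)] .
  moreover have "fst (pm (0, p)) > k" using targets[OF s(2)] target_p k_less_l kl_less by auto
  ultimately show ?thesis using targets[OF s(1)] pm_less_q(1)[OF assms(2)] by auto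
qed

text \<open>An edge is filled by its predecessor in the list and by the points entering from
  \<open>e_0\<close>, and the two contributions are disjoint.\<close>

lemma N_succ:
  assumes "0 < r" "r < n"
  shows "N ((r + m) mod n) = N r + card {s. s < N 0 \<and> fst (pm (0, s)) = (r + m) mod n}"
proof -
  let ?r' = "(r + m) mod n"
  let ?I = "{s. s < N 0 \<and> fst (pm (0, s)) = ?r'}"
  let ?X = "Pair r ` {..<N r} \<union> Pair 0 ` ?I"
  have X_L: "?X \<subseteq> L" using assms n_pos L_iff by auto
  have "pm ` ?X = Pair ?r' ` {..<N ?r'}"
  proof (intro equalityI subsetI)
    fix y assume "y \<in> pm ` ?X"
    then obtain a b where ab: "(a, b) \<in> ?X" "y = pm (a, b)" by auto
    then have "fst y = ?r'" using pm_edge assms by auto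
    moreover have "snd y < N (fst y)" using ab X_L pm_in[of a b] L_iff by blast
    ultimately show "y \<in> Pair ?r' ` {..<N ?r'}" by (cases y) auto
  next
    fix y assume "y \<in> Pair ?r' ` {..<N ?r'}"
    then obtain t where t: "y = (?r', t)" "t < N ?r'" by auto
    obtain a b where ab: "a < n" "b < N a" "pm (a, b) = (?r', t)"
      using pm_onto[OF succ_less t(2)] by blast
    have "(a, b) \<in> ?X"
    proof (cases "a = 0")
      case True
      then show ?thesis using ab by auto
    next
      case False
      then have "(a + m) mod n = ?r'" using pm_edge[of a b] ab by simp
      then have "a = r" using ps_step[of a] ps_step[of r] E_ps False ab assms
        by (metis Suc_inject gr_implies_not0)
      then show ?thesis using ab by auto
    qed
    then have "pm (a, b) \<in> pm ` ?X" by (rule imageI)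
    then show "y \<in> pm ` ?X" unfolding ab(3) t(1) .
  qed
  then have "card ?X = N ?r'"
    using card_image[OF inj_on_subset[OF inj X_L]] card_image[of "Pair ?r'" "{..<N ?r'}"]
    by (simp add: inj_on_def)
  moreover have "card ?X = card (Pair r ` {..<N r}) + card (Pair (0::nat) ` ?I)"
    using assms by (intro card_Un_disjoint) auto
  ultimately show ?thesis by (simp add: card_image inj_on_def)
qed

lemma inserted_k: "{s. s < N 0 \<and> fst (pm (0, s)) = k} = {..<p}"
proof (intro equalityI subsetI)
  fix s assume s: "s \<in> {s. s < N 0 \<and> fst (pm (0, s)) = k}"
  show "s \<in> {..<p}"
  proof (rule ccontr)
    assume "s \<notin> {..<p}"
    then have "s = q \<or> fst (pm (0, s)) = l" using target_ge_p[of s] s N_0 by force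
    then show False using s pm_q k_less_l kl_less by auto
  qed
qed (use target_less_p p_le_q N_0 in auto)

lemma inserted_l: "{s. s < N 0 \<and> fst (pm (0, s)) = l} = {p..<q}"
proof (intro equalityI subsetI)
  fix s assume s: "s \<in> {s. s < N 0 \<and> fst (pm (0, s)) = l}"
  then have "s \<noteq> q" using pm_q l_less_m by auto
  moreover have "\<not> s < p" using target_less_p[of s] s k_less_l by auto
  ultimately show "s \<in> {p..<q}" using s N_0 by auto
qed (use target_ge_p N_0 in auto)

lemma inserted_none: "r \<noteq> k \<Longrightarrow> r \<noteq> l \<Longrightarrow> r \<noteq> m \<Longrightarrow> {s. s < N 0 \<and> fst (pm (0, s)) = r} = {}"
  using targets by blast

text \<open>Along the list the count starts at 1, grows by \<open>q - p\<close> at \<open>l\<close>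
  and by \<open>p\<close> at \<open>k\<close>, and is constant elsewhere.\<close>

lemma N_eq: assumes "r < n" shows "N r = Nexp p q r"
proof -
  have "N (E j) = Nexp p q (E j)" if "j < n" for j
    using that
  proof (induction j)
    case 0
    then show ?case using N_m ps_m ps_l_pos E_0 by (simp add: Nexp_def)
  next
    case (Suc j)
    have j: "0 < E j" "E j < n" using E_eq_0_iff[of j] Suc.prems E_less by auto
    have ps: "ps (E (Suc j)) = Suc j" "ps (E j) = j" using ps_E Suc.prems by auto
    have IH: "N (E j) = Nexp p q (E j)" using Suc by simp
    have succ: "N (E (Suc j)) = N (E j) + card {s. s < N 0 \<and> fst (pm (0, s)) = E (Suc j)}"
      using N_succ[OF j] by (simp add: E_Suc)
    consider "E (Suc j) = k" | "E (Suc j) = l" | "E (Suc j) \<noteq> k" "E (Suc j) \<noteq> l" by blast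
    then show ?case
    proof cases
      case 1
      then have "ps k = Suc j" using ps by simp
      then show ?thesis using succ IH ps ps_l_k p_le_q unfolding 1 inserted_k Nexp_def by auto
    next
      case 2
      then have "ps l = Suc j" using ps by simp
      then show ?thesis using succ IH ps ps_l_k p_le_q unfolding 2 inserted_l Nexp_def by auto
    next
      case 3
      then have "ps k \<noteq> Suc j" "ps l \<noteq> Suc j" using E_ps kl_less by metis+
      moreover have "E (Suc j) \<noteq> m" using ps ps_m by auto
      ultimately show ?thesis using succ IH ps ps_l_k inserted_none[OF 3] by (auto simp: Nexp_def)
    qed
  qed
  then show ?thesis using E_ps[OF assms] ps_less[OF assms] by metis
qed

text \<open>Either the edge has one point, or no point enters the next edge; then second coordinates
  undergo a strictly increasing self-map, which is the identity.\<close>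

lemma pm_shift:
  assumes "0 < r" "r < n" "r \<noteq> k + n - m" "s < N r"
  shows "pm (r, s) = ((r + m) mod n, s)"
proof (cases "N r = 1")
  case True
  then show ?thesis using pm_min assms by simp
next
  case False
  let ?r' = "(r + m) mod n"
  have "ps l \<le> ps r" using False N_R[OF assms(2)] by fastforce
  moreover have "?r' \<noteq> k" using succ_eq_iff[OF assms(2), of k] assms(3) kl_less by simp
  then have "ps k \<noteq> ps ?r'" using E_ps kl_less(1) succ_less by metis
  moreover have "ps ?r' = Suc (ps r)" using ps_step assms by simp
  ultimately have "N ?r' = N r"
    using N_eq[OF assms(2)] N_eq[OF succ_less, of r] unfolding Nexp_def by auto
  then have "snd (pm (r, s)) = s"
    by (intro strict_increasing_self_map_id[of "N r" "\<lambda>s. snd (pm (r, s))"])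
      (use pm_edge_mono pm_edge pm_in assms in \<open>auto, metis\<close>)
  then show ?thesis using pm_edge assms by (metis prod.collapse)
qed

lemma N_T: "r < n \<Longrightarrow> ps k \<le> ps r \<Longrightarrow> N r = Suc q"
  using N_eq ps_l_k by (simp add: Nexp_def)

lemma N_S: "r < n \<Longrightarrow> ps l \<le> ps r \<Longrightarrow> ps r < ps k \<Longrightarrow> N r = Suc (q - p)"
  using N_eq ps_l_k p_le_q by (simp add: Nexp_def Suc_diff_le)

end

lemma (in rotation) coloured_orbitI:
  assumes cyc: "cyclic_map pm (labels (map N [0..<n]))"
    and N_pos: "\<And>r. r < n \<Longrightarrow> 0 < N r"
    and pm_min: "\<And>r. 0 < r \<Longrightarrow> r < n \<Longrightarrow> pm (r, 0) = ((r + m) mod n, 0)"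
  shows "coloured_orbit pm (map N [0..<n]) m n"
proof -
  interpret cyclic_map pm "labels (map N [0..<n])" by (fact cyc)
  have pow: "(pm ^^ j) (m, 0) = (E j, 0)" if "j < n" for j
    using that
  proof (induction j)
    case (Suc j)
    then have "E j \<noteq> 0" using E_eq_0_iff[of j] by auto
    then show ?case using Suc pm_min[of "E j"] E_less by (simp add: E_Suc)
  qed (simp add: E_0)
  have mins: "{y \<in> labels (map N [0..<n]). snd y = 0} = (\<lambda>r. (r, 0)) ` {..<n}"
    using N_pos by (auto simp: labels_map)
  show ?thesis
  proof
    show "card (labels (map N [0..<n])) = sum_list (map N [0..<n])" by (rule card_labels)
    show "0 < n" using m_small by simp
    show "(m, 0) \<in> labels (map N [0..<n])" using N_pos[of m] m_small by (simp add: labels_map)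
    have "(\<lambda>j. (pm ^^ j) (m, 0)) ` {..<n} = (\<lambda>j. (E j, 0)) ` {..<n}"
      using pow by (intro image_cong) auto
    also have "\<dots> = (\<lambda>r. (r, 0)) ` E ` {..<n}" by (simp add: image_image)
    finally show "(\<lambda>j. (pm ^^ j) (m, 0)) ` {..<n} = {y \<in> labels (map N [0..<n]). snd y = 0}"
      unfolding mins E_image .
    show "card {y \<in> labels (map N [0..<n]). snd y = 0} = n"
      unfolding mins by (simp add: card_image inj_on_def)
  qed
qed

section \<open>The colours determine the permutation\<close>

context tt_orbit
begin

sublocale coloured_orbit pm "map N [0..<n]" m n A B C
  by (intro coloured_orbitI N_pos pm_min) (unfold_locales)

definition c where "c = (SOME c. colour_law c)"

lemma c_law: "colour_law c"
  unfolding c_def using colour_law_exists by (rule someI_ex)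

lemma alpha_iff: "y \<in> alphaS n m D \<longleftrightarrow> y \<in> L \<and> 0 < snd y \<and> \<not> c y"
  unfolding colour_sets(2)[OF c_law] by simp

lemma beta_iff: "y \<in> betaS n m D \<longleftrightarrow> y \<in> L \<and> 0 < snd y \<and> c y"
  unfolding colour_sets(1)[OF c_law] by simp

lemma TT_0:
  assumes "s < q"
  shows "s \<in> B \<Longrightarrow> \<not> c (pm (0, s))" "s \<in> A \<Longrightarrow> c (pm (0, s))"
proof -
  have "(s \<in> B \<longrightarrow> pm (0, s) \<in> alphaS n m D) \<and> (s \<in> A \<longrightarrow> pm (0, s) \<in> betaS n m D)"
    using TT assms N_0 n_pos unfolding TTcond_def by simp
  then show "s \<in> B \<Longrightarrow> \<not> c (pm (0, s))" "s \<in> A \<Longrightarrow> c (pm (0, s))"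
    unfolding alpha_iff beta_iff by blast+
qed

lemma AB_less_q:
  assumes "s < q" shows "s \<in> A \<longleftrightarrow> odd (piece s)" "s \<in> B \<longleftrightarrow> even (piece s)" "s \<notin> C"
  using ABC_inner[of s] pm_less_q[OF assms] assms N_0 by auto

lemma c_q: "c (0, q)" if "0 < q"
proof -
  have "(0, q) \<in> L" using L_iff N_0 n_pos by simp
  then show ?thesis using c_law that pm_q unfolding colour_law_def by (metis snd_conv)
qed

text \<open>By (a) the image of a label in \<open>B\<close> is in \<alpha> and passes its colour
  back unchanged, while the image of a label in \<open>A\<close> is in \<beta> and passes it back
  flipped.\<close>

lemma c_0:
  assumes "0 < s" "s < q" shows "\<not> c (0, s)"
proof -
  have "(0, s) \<in> L" using L_iff N_0 n_pos assms by simp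
  moreover have "pm (0, s) \<noteq> (m, 0)" using pm_less_q[OF assms(2)] by auto
  ultimately have "c (0, s) = (c (pm (0, s)) \<noteq> (s \<in> A))"
    using c_law assms(1) unfolding colour_law_def by (metis fst_conv snd_conv)
  then show ?thesis using TT_0[OF assms(2)] AB_less_q[OF assms(2)] by blast
qed

lemma c_edge:
  assumes "0 < r" "r < n" "0 < s" "s < N r"
  shows "c (r, s) = c (pm (r, s))"
proof -
  have "(r, s) \<in> L" using L_iff assms by simp
  moreover have "pm (r, s) \<noteq> (m, 0)"
    using pm_edge[of r s] succ_eq_m_iff[of r] assms by (metis fst_conv less_irrefl)
  ultimately show ?thesis using c_law assms unfolding colour_law_def by (metis fst_conv snd_conv less_irrefl)
qed

lemma q_pos: "0 < q" using p_pos p_le_q by simp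

text \<open>From \<open>k\<close> on labels and colours move unchanged up to \<open>e_0\<close>,
  where only \<open>(0, q)\<close> is in \<beta>; the induction is on the distance to the end of the
  list.\<close>

lemma c_T:
  assumes "r < n" "ps k \<le> ps r" "0 < s" "s \<le> q"
  shows "c (r, s) \<longleftrightarrow> s = q"
  using assms(1,2)
proof (induction "n - ps r" arbitrary: r rule: less_induct)
  case less
  show ?case
  proof (cases "r = 0")
    case True
    then show ?thesis using c_q[OF q_pos] c_0[OF assms(3)] assms(4) by (metis le_neq_implies_less)
  next
    case False
    let ?r' = "(r + m) mod n"
    have ps: "ps ?r' = Suc (ps r)" using ps_step False less.prems by simp
    have "r \<noteq> k + n - m" using prev_edge[of k] kl_less less.prems by auto
    moreover have s: "s < N r" using N_T[OF less.prems] assms(4) by simp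
    ultimately have "pm (r, s) = (?r', s)" using pm_shift False less.prems by simp
    then have "c (r, s) = c (?r', s)" using c_edge[of r s] False less.prems s assms(3) by simp
    moreover have "n - ps ?r' < n - ps r" using ps ps_less[OF succ_less, of r] by linarith
    ultimately show ?thesis using less.hyps[of ?r'] ps succ_less less.prems by simp
  qed
qed

text \<open>\<open>pre\<close> is the edge before \<open>k\<close>. There the transported points
  meet the \<open>p\<close> newcomers from \<open>e_0\<close>, so \<open>g\<close> is the one
  transport that may shift labels.\<close>

definition "pre = k + n - m"
definition "g s = snd (pm (pre, s))"

lemma pre: "0 < pre" "pre < n" "(pre + m) mod n = k" "ps k = Suc (ps pre)" "N pre = Suc (q - p)"
proof -
  show pr: "0 < pre" "pre < n" "(pre + m) mod n = k" "ps k = Suc (ps pre)"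
    using prev_edge[of k] kl_less by (auto simp: pre_def)
  show "N pre = Suc (q - p)" using N_S[OF pr(2)] pr ps_l_k by simp
qed

lemma pm_pre: "s \<le> q - p \<Longrightarrow> pm (pre, s) = (k, g s)"
  using pm_edge[of pre s] pre unfolding g_def by (metis less_Suc_eq_le prod.collapse)

lemma g_mono: "s < t \<Longrightarrow> t \<le> q - p \<Longrightarrow> g s < g t"
  unfolding g_def using pm_edge_mono pre by simp

lemma g_0: "g 0 = 0" using pm_min[of pre] pre by (simp add: g_def)

lemma g_le: "s \<le> q - p \<Longrightarrow> g s \<le> q"
  using pm_in[of pre s] pm_pre[of s] pre N_T[of k] kl_less by simp

text \<open>A label \<open>s\<close> reaches \<open>pre\<close> unchanged and enters
  \<open>k\<close> at height \<open>g s\<close>, where \<open>c_T\<close> reads off its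
  colour.\<close>

lemma c_S:
  assumes "r < n" "ps l \<le> ps r" "ps r < ps k" "0 < s" "s \<le> q - p"
  shows "c (r, s) \<longleftrightarrow> g s = q"
  using assms(1-3)
proof (induction "ps k - ps r" arbitrary: r rule: less_induct)
  case less
  have r0: "r \<noteq> 0"
  proof
    assume "r = 0"
    then show False using less.prems ps_0 ps_less[of k] kl_less by simp
  qed
  have s: "s < N r" using N_S[OF less.prems] assms(5) by simp
  have step: "c (r, s) = c (pm (r, s))" using c_edge[of r s] r0 less.prems s assms(4) by simp
  show ?case
  proof (cases "r = pre")
    case True
    have "0 < g s" using g_mono[of 0 s] assms by simp
    then show ?thesis using step c_T[of k "g s"] g_le[OF assms(5)] pm_pre[OF assms(5)] kl_less True by simp
  next
    case False
    let ?r' = "(r + m) mod n"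
    have ps: "ps ?r' = Suc (ps r)" using ps_step r0 less.prems by simp
    have "Suc (ps r) \<noteq> ps k" using False pre E_ps[of r] E_ps[of pre] less.prems by auto
    moreover have "pm (r, s) = (?r', s)" using pm_shift r0 less.prems s False by (simp add: pre_def)
    ultimately show ?thesis using step less.hyps[of ?r'] ps succ_less less.prems by simp
  qed
qed

lemma piece_less_p: "s < p \<Longrightarrow> piece s = 2 * k"
  using target_less_p[of s] pm_0[of s] piece_ge[of s] p_le_q N_0 by simp

text \<open>The label \<open>(k, q)\<close> is in \<beta>. Newcomers at \<open>k\<close> come from
  the even piece \<open>2 * k\<close>, hence from \<open>B\<close>, and have images in \<alpha> by
  (a). So \<open>(k, q)\<close> comes from \<open>pre\<close>, and by monotonicity from its last
  label, which is not 0 because \<open>g 0 = 0\<close>.\<close>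

lemma g_top: "g (q - p) = q" "p < q"
proof -
  have ck: "c (k, q)" using c_T[of k q] kl_less q_pos by simp
  obtain r s where rs: "r < n" "s < N r" "pm (r, s) = (k, q)"
    using pm_onto[of k q] N_T[of k] kl_less by auto
  have "r \<noteq> 0"
  proof
    assume r: "r = 0"
    then have "s < p" using rs inserted_k by (metis (mono_tags, lifting) fst_conv lessThan_iff mem_Collect_eq)
    then have "s < q" "s \<in> B" using p_le_q piece_less_p[of s] AB_less_q(2)[of s] by auto
    then show False using TT_0(1)[of s] rs ck r by simp
  qed
  then have "r = pre"
    using pm_edge[of r s] rs succ_eq_iff[of r k] kl_less unfolding pre_def by (metis fst_conv gr0I)
  then have s: "s \<le> q - p" "g s = q" using rs pre by (auto simp: g_def)
  then have "s = q - p" using g_mono[of s "q - p"] g_le[of "q - p"] by fastforce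
  then show "g (q - p) = q" using s by simp
  then show "p < q" using g_0 q_pos by (metis neq0_conv zero_less_diff)
qed

lemma pm_l_in: "(l, s) \<in> L \<longleftrightarrow> s \<le> q - p"
  using L_iff N_S[of l] kl_less ps_l_k by auto

lemma c_l: "0 < s \<Longrightarrow> s \<le> q - p \<Longrightarrow> c (l, s) \<longleftrightarrow> s = q - p"
  using c_S[of l s] kl_less ps_l_k g_top g_mono[of s "q - p"] by (metis le_neq_implies_less less_irrefl order_refl)

lemma target_l_le:
  assumes "p \<le> s" "s < q" shows "snd (pm (0, s)) \<le> q - p"
proof -
  have "pm (0, s) \<in> L" using closed L_iff N_0 n_pos assms by simp
  then show ?thesis using pm_l_in target_ge_p[OF assms] by (metis prod.collapse)
qed

text \<open>Such a label is in \<open>A\<close>, so its image is in \<beta>. All newcomers at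
  \<open>k\<close> come from an even piece, hence the target is \<open>l\<close>, where
  \<open>q - p\<close> is the only positive \<beta>-label.\<close>

lemma odd_piece:
  assumes "s < q" "odd (piece s)"
  shows "p \<le> s" "pm (0, s) = (l, q - p)"
proof -
  show ps: "p \<le> s" using piece_less_p[of s] assms(2) by fastforce
  have t: "fst (pm (0, s)) = l" using target_ge_p[OF ps assms(1)] .
  have "c (pm (0, s))" using TT_0(2)[OF assms(1)] AB_less_q(1)[OF assms(1)] assms(2) by simp
  then have "snd (pm (0, s)) = q - p"
    using c_l pm_less_q(2)[OF assms(1)] target_l_le[OF ps assms(1)] t by (metis prod.collapse)
  then show "pm (0, s) = (l, q - p)" using t by (metis prod.collapse)
qed

lemma odd_piece_unique:
  assumes "s < q" "t < q" "odd (piece s)" "odd (piece t)"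
  shows "s = t"
  using odd_piece(2)[of s] odd_piece(2)[of t] assms pm_inj[of 0 s 0 t] L_iff N_0 n_pos by simp

text \<open>The label \<open>(l, q - p)\<close> is in \<beta> and positive, while the predecessor of
  \<open>l\<close> supplies only \<open>(l, 0)\<close>. So it comes from \<open>e_0\<close>, and
  from an odd piece, since an even one would give \<alpha>.\<close>

lemma odd_piece_p: "odd (piece p)"
proof -
  have cl: "c (l, q - p)" using c_l g_top(2) by simp
  have "(l, q - p) \<in> L" using pm_l_in by simp
  then obtain r s where rs: "r < n" "s < N r" "pm (r, s) = (l, q - p)"
    using pm_onto[of l "q - p"] L_iff by metis
  have "r = 0"
  proof (rule ccontr)
    assume r: "r \<noteq> 0"
    then have "r = l + n - m" using pm_edge[of r s] rs succ_eq_iff[of r l] l_less_m by simp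
    then have "N r = 1" using N_R[OF rs(1)] prev_edge[OF l_less_m] by simp
    then have "pm (r, s) = ((r + m) mod n, 0)" using rs r pm_min[of r] by simp
    then show False using rs g_top(2) by simp
  qed
  then have s: "p \<le> s" "s < q" using inserted_l rs
    by (metis (mono_tags, lifting) atLeastLessThan_iff fst_conv mem_Collect_eq)+
  have odd: "odd (piece s)"
    using TT_0(1)[OF s(2)] AB_less_q(2)[OF s(2)] rs cl \<open>r = 0\<close> by auto
  have "piece s = 2 * l - 1" if "odd (piece s)" "p \<le> s" "s < q" for s
    using that pm_0[of s] target_ge_p[of s] N_0 by (elim oddE) simp
  then have ps: "piece s = 2 * l - 1" using odd s by blast
  have "piece p \<le> piece s" using piece_mono[of p s] s N_0 by (cases "p = s") auto
  moreover have "(piece p + 1) div 2 = l" using pm_0[of p] target_ge_p[of p] g_top(2) N_0 by simp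
  \<comment> \<open>The edge \<open>l\<close> is covered by the pieces \<open>2 * l - 1\<close> and
    \<open>2 * l\<close>, the odd one first; \<open>p\<close>, the first label sent to
    \<open>l\<close>, cannot come after a label in the odd piece.\<close>
  ultimately have "piece p = 2 * l - 1" using ps k_less_l by linarith
  then show ?thesis using k_less_l by simp
qed

lemma odd_piece_iff: "s < q \<Longrightarrow> odd (piece s) \<longleftrightarrow> s = p"
  using odd_piece_p odd_piece_unique[of s p] g_top(2) by blast

lemma ABC_eq: "A = {p}" "B = {0..<q} - {p}" "C = {q}"
proof -
  have less: "s < q \<or> s = q" if "s \<in> A \<union> B \<union> C" for s
    using that ABC_bounded N_0 by (auto simp: less_Suc_eq)
  have "q \<notin> A \<and> q \<notin> B \<and> q \<in> C" using ABC_min[of q] q_pos N_0 pm_q by simp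
  then have mem: "s \<in> A \<longleftrightarrow> s = p" "s \<in> B \<longleftrightarrow> s < q \<and> s \<noteq> p" "s \<in> C \<longleftrightarrow> s = q" for s
    using less[of s] AB_less_q[of s] odd_piece_iff[of s] g_top(2) by blast+
  show "A = {p}" "B = {0..<q} - {p}" "C = {q}" by (auto simp: mem)
qed

lemma pm_p: "pm (0, p) = (l, q - p)"
  using odd_piece(2)[of p] odd_piece_p g_top(2) by simp

lemma pm_gt_p:
  assumes "p < s" "s < q"
  shows "pm (0, s) = (l, s - p)"
proof -
  \<comment> \<open>The slot \<open>(l, 0)\<close> belongs to the predecessor of \<open>l\<close>
    and \<open>(l, q - p)\<close> to \<open>p\<close>. Adding the value 0 at 0 completes the
    remaining labels to an increasing self-map of \<open>{0..<q - p}\<close>.\<close>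
  let ?h = "\<lambda>t. if t = 0 then 0 else snd (pm (0, p + t))"
  have piece: "piece (p + t) = 2 * l" if "0 < t" "t < q - p" for t
  proof -
    have "even (piece (p + t))" using odd_piece_iff[of "p + t"] that by simp
    moreover have "(piece (p + t) + 1) div 2 = l"
      using pm_0[of "p + t"] target_ge_p[of "p + t"] that N_0 by simp
    ultimately show ?thesis by (elim evenE) simp
  qed
  have bound: "?h t < q - p" if "t < q - p" for t
  proof (cases "t = 0")
    case False
    have "snd (pm (0, p + t)) \<noteq> q - p"
    proof
      assume "snd (pm (0, p + t)) = q - p"
      then have "pm (0, p + t) = pm (0, p)"
        using target_ge_p[of "p + t"] that pm_p by (metis le_add1 less_diff_conv add.commute prod.collapse)
      moreover have "p + t < N 0" "p < N 0" using that N_0 by linarith+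
      ultimately show False using pm_inj[of 0 "p + t" 0 p] L_iff n_pos False by simp
    qed
    moreover have "snd (pm (0, p + t)) \<le> q - p" by (rule target_l_le) (use that in linarith)+
    ultimately show ?thesis using False by simp
  qed (use that in simp)
  have mono: "?h t < ?h u" if "t < u" "u < q - p" for t u
  proof (cases "t = 0")
    case True
    then show ?thesis using pm_less_q(2)[of "p + u"] that by simp
  next
    case False
    then show ?thesis using pm_0_mono[of "p + t" "p + u"] piece[of t] piece[of u] that N_0 by simp
  qed
  have "?h (s - p) = s - p"
    by (rule strict_increasing_self_map_id[OF mono bound]) (use assms in auto)
  then have "snd (pm (0, s)) = s - p" using assms by simp
  then show ?thesis using target_ge_p[of s] assms by (metis less_imp_le_nat prod.collapse)
qed

text \<open>Below the top only \<alpha>-labels arrive from \<open>pre\<close>, and by (c) one lying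
  above the first newcomer would be in \<beta>. So these arrivals precede all newcomers, and the two
  streams concatenate to an increasing self-map of \<open>{0..<q}\<close>, the slot \<open>q\<close>
  being taken by \<open>g (q - p)\<close>.\<close>

lemma merge_at_k:
  shows "t < q - p \<Longrightarrow> g t = t" "s < p \<Longrightarrow> pm (0, s) = (k, q - p + s)"
proof -
  let ?h = "\<lambda>s. snd (pm (0, s))"
  let ?e = "\<lambda>t. if t < q - p then g t else ?h (t - (q - p))"
  have h_le: "?h s \<le> q" if "s < p" for s
    using pm_in[of 0 s] target_less_p[OF that] N_T[of k] kl_less that p_le_q N_0 n_pos by simp
  have ne: "g t \<noteq> ?h s" if "t \<le> q - p" "s < p" for t s
  proof
    assume "g t = ?h s"
    then have "pm (pre, t) = pm (0, s)" using pm_pre[OF that(1)] target_less_p[OF that(2)] by (metis prod.collapse)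
    then show False using pm_inj[of pre t 0 s] L_iff pre that p_le_q N_0 n_pos by simp
  qed
  have g_less: "g t < ?h 0" if "t < q - p" for t
  proof (cases "t = 0")
    case True
    then show ?thesis using g_0 pm_less_q(2)[of 0] q_pos by simp
  next
    case False
    have "g t \<noteq> q" using g_mono[of t "q - p"] g_top that by simp
    then have "\<not> c (pm (pre, t))"
      using c_T[of k "g t"] g_mono[of 0 t] g_le[of t] pm_pre[of t] kl_less that False by simp
    then have "pm (pre, t) \<notin> betaS n m D" unfolding beta_iff by blast
    moreover have "t < map N [0..<n] ! (k + n - m)"
      using pre that by (simp add: pre_def[symmetric])
    ultimately have "\<not> g t > ?h 0"
      using TT False unfolding TTcond_def g_def pre_def by auto
    then show ?thesis using ne[of t 0] that p_pos by (simp add: linorder_neq_iff)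
  qed
  have h_mono: "?h s < ?h t" if "s < t" "t < p" for s t
    using pm_0_mono[of s t] piece_less_p[of s] piece_less_p[of t] that p_le_q N_0 by simp
  have h_ge: "?h 0 \<le> ?h s" if "s < p" for s
    using h_mono[of 0 s] that by (cases "s = 0") auto
  have mono: "?e t < ?e u" if "t < u" "u < q" for t u
  proof (cases "u < q - p")
    case True
    then show ?thesis using g_mono that by simp
  next
    case u: False
    then have up: "u - (q - p) < p" using that p_le_q by linarith
    show ?thesis
    proof (cases "t < q - p")
      case True
      then show ?thesis using g_less[of t] h_ge[OF up] u by simp
    next
      case False
      then show ?thesis using h_mono[of "t - (q - p)" "u - (q - p)"] up u that by simp
    qed
  qed
  have bound: "?e t < q" if "t < q" for t
  proof (cases "t < q - p")
    case True
    then show ?thesis using g_mono[of t "q - p"] g_top by simp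
  next
    case False
    then have "t - (q - p) < p" using that p_le_q by linarith
    then show ?thesis using h_le[of "t - (q - p)"] ne[of "q - p" "t - (q - p)"] g_top False
      by (simp add: le_neq_implies_less)
  qed
  have e: "?e t = t" if "t < q" for t
    by (rule strict_increasing_self_map_id[OF mono bound that])
  show "g t = t" if "t < q - p" for t using e[of t] that by simp
  show "pm (0, s) = (k, q - p + s)" if "s < p" for s
  proof -
    have "q - p + s < q" "\<not> q - p + s < q - p" using that p_le_q by linarith+
    then have "?h s = q - p + s" using e[of "q - p + s"] by (simp only: if_False diff_add_inverse)
    then show ?thesis using target_less_p[OF that] by (metis prod.collapse)
  qed
qed

lemma pm_eq:
  assumes "y \<in> L" shows "pm y = pexp p q y"
proof -
  obtain r s where y: "y = (r, s)" by (cases y)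
  have rs: "r < n" "s < N r" using assms L_iff y by auto
  show ?thesis
  proof (cases "r = 0")
    case True
    then consider "s < p" | "s = p" | "p < s" "s < q" | "s = q" using rs N_0 by fastforce
    then show ?thesis
      by cases (use True y merge_at_k(2) pm_p pm_gt_p pm_q g_top(2) in \<open>auto simp: pexp_def Let_def\<close>)
  next
    case False
    show ?thesis
    proof (cases "r = pre")
      case True
      then have "s \<le> q - p" using rs pre by simp
      then show ?thesis using pm_pre[of s] merge_at_k(1)[of s] g_top(1) True False y pre(3)
        by (cases "s = q - p") (auto simp: pexp_def Let_def pre_def)
    next
      case r: False
      then show ?thesis using pm_shift[of r s] rs False y by (simp add: pexp_def Let_def pre_def)
    qed
  qed
qed

lemma coprime_p_q: "coprime p q"
proof -
  define d where "d = gcd p q"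
  have d: "d dvd p" "d dvd q" by (auto simp: d_def)
  have "{y \<in> L. d dvd snd y} = L"
  proof (rule invariant_subset)
    show "(0, 0) \<in> {y \<in> L. d dvd snd y}" using L_iff N_0 n_pos by simp
    fix y assume y: "y \<in> {y \<in> L. d dvd snd y}"
    \<comment> \<open>Every clause of \<open>pexp\<close> alters the second coordinate by an integer
      combination of \<open>p\<close> and \<open>q\<close> or sets it to one.\<close>
    then have "d dvd snd (pexp p q y)" using d by (auto simp: pexp_def Let_def)
    then show "pm y \<in> {y \<in> L. d dvd snd y}" using y closed pm_eq by simp
  qed blast
  moreover have "(0, 1) \<in> L" using L_iff N_0 n_pos q_pos by simp
  ultimately have "(0, 1) \<in> {y \<in> L. d dvd snd y}" by simp
  then have "d dvd 1" by simp
  then show ?thesis by (simp add: d_def coprime_iff_gcd_eq_1)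
qed

lemma D_eq: "D = Dpq p q"
proof -
  have N: "map N [0..<n] = map (Nexp p q) [0..<n]" using N_eq by simp
  have "pm = (\<lambda>y. if y \<in> L then pexp p q y else undefined)"
    using pm_eq pm_undefined by auto
  then show ?thesis unfolding Dpq_def N[symmetric] using ABC_eq by simp
qed

end

lemma (in rotation_pair) TTset_imp_Dpq:
  assumes "X \<in> TTset n m k GB"
  shows "\<exists>p q. 0 < p \<and> p < q \<and> coprime p q \<and> X = Dpq p q"
proof -
  obtain P where P: "X = odata n m P" "star_orbit n m P" "Pcond k GB (odata n m P)"
    "TTcond n m k GB (odata n m P)"
    using assms unfolding TTset_def by blast
  let ?piece = "\<lambda>s. nat \<lfloor>(2 * real m + 1) * labpar P 0 s\<rfloor>"
  interpret star_coords n m "labpar P" "Ncnt P" P "piP n m P" ?piece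
    by (rule star_orbit_coords[OF P(2)])
  define A where "A = {s. s < Ncnt P 0 \<and> loc_rev n m P (labpar P 0 s)}"
  define B where "B = {s. s < Ncnt P 0 \<and> loc_pres n m P (labpar P 0 s)}"
  define C where "C = {s. s < Ncnt P 0 \<and> loc_noninj n m P (labpar P 0 s)}"
  have X: "odata n m P = (map (Ncnt P) [0..<n], piP n m P, A, B, C)"
    by (simp add: odata_def A_def B_def C_def Nlist_eq)
  interpret tt_orbit n m k l "piP n m P" "Ncnt P" ?piece A B C
  proof (intro tt_orbit.intro rotation_pair_axioms star_orbit_piP_cyclic[OF P(2)] tt_orbit_axioms.intro)
    fix r s t assume r: "0 < r" "r < n" and st: "s < t" "t < Ncnt P r"
    let ?a = "piP n m P (r, s)" and ?b = "piP n m P (r, t)"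
    have s: "s < Ncnt P r" using st by simp
    have e: "fst ?b = fst ?a" using pm_edge r s st(2) by simp
    have "labpar P (fst ?a) (snd ?a) < labpar P (fst ?a) (snd ?b)"
      using x_edge[OF r s] x_edge[OF r st(2)] x_mono[OF r(2) st] unfolding e by simp
    then show "snd ?a < snd ?b"
      using x_less_iff[of "fst ?a" "snd ?a" "snd ?b"] pm_in[OF r(2) s] pm_in[OF r(2) st(2)] e by simp
  next
    fix s assume s: "s < Ncnt P 0"
    have "(2 * real m + 1) * labpar P 0 s < (2 * real m + 1) * 1"
      using x_less_1[OF n_pos s] by (intro mult_strict_left_mono) auto
    then have "(2 * real m + 1) * labpar P 0 s < of_int (2 * int m + 1)" by (simp only: of_int_add of_int_mult of_int_numeral of_int_1 of_int_of_nat_eq mult_1_right)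
    then have "\<lfloor>(2 * real m + 1) * labpar P 0 s\<rfloor> < 2 * int m + 1" unfolding floor_less_iff .
    then show "?piece s \<le> 2 * m" by linarith
  next
    fix s t assume st: "s < t" "t < Ncnt P 0"
    have s: "s < Ncnt P 0" using st by simp
    have lt: "(2 * real m + 1) * labpar P 0 s < (2 * real m + 1) * labpar P 0 t"
      using x_mono[OF n_pos st] by (intro mult_strict_left_mono) auto
    then show "?piece s \<le> ?piece t" by (intro nat_mono floor_mono) simp
    assume eq: "?piece s = ?piece t" and ev: "even (?piece s)"
    let ?a = "piP n m P (0, s)" and ?b = "piP n m P (0, t)"
    have e: "fst ?b = fst ?a" using pm_0[OF s] pm_0[OF st(2)] eq by simp
    have evt: "even (?piece t)" using eq ev by simp
    have "(2 * real m + 1) * labpar P 0 s = real (?piece s) + labpar P (fst ?a) (snd ?a)"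
      using x_0[OF s] ev by presburger
    moreover have "(2 * real m + 1) * labpar P 0 t = real (?piece t) + labpar P (fst ?b) (snd ?b)"
      using x_0[OF st(2)] evt by presburger
    moreover have "real (?piece s) = real (?piece t)" using eq by simp
    ultimately have "labpar P (fst ?a) (snd ?a) < labpar P (fst ?b) (snd ?b)"
      using lt by linarith
    then show "snd ?a < snd ?b"
      using x_less_iff[of "fst ?a" "snd ?a" "snd ?b"] pm_in[OF n_pos s] pm_in[OF n_pos st(2)] e by simp
  next
    fix y assume "y \<notin> labels (map (Ncnt P) [0..<n])"
    then show "piP n m P y = undefined" by (simp add: piP_def Nlist_eq)
  next
    show "A \<subseteq> {..<Ncnt P 0}" "B \<subseteq> {..<Ncnt P 0}" "C \<subseteq> {..<Ncnt P 0}"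
      by (auto simp: A_def B_def C_def)
  next
    fix s assume "s < Ncnt P 0" "0 < snd (piP n m P (0, s))"
    then show "(s \<in> A \<longleftrightarrow> odd (?piece s)) \<and> (s \<in> B \<longleftrightarrow> even (?piece s)) \<and> s \<notin> C"
      using local_type_inner[of s] unfolding A_def B_def C_def by blast
  next
    fix s assume "0 < s" "s < Ncnt P 0" "snd (piP n m P (0, s)) = 0"
    then show "s \<notin> A \<and> s \<notin> B \<and> s \<in> C"
      using local_type_min[of s] unfolding A_def B_def C_def by blast
  next
    show "fst (piP n m P (0, 0)) = k" "0 \<in> B" using P(3) unfolding X Pcond_def by auto
    show "TTcond n m k GB (map (Ncnt P) [0..<n], piP n m P, A, B, C)" using P(4) unfolding X .
  qed (use N_pos pm_edge pm_0 star_orbit_piP_min[OF P(2)] in auto)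
  show ?thesis using p_pos g_top(2) coprime_p_q D_eq P(1) X by metis
qed

section \<open>Realisation of the data of a rational\<close>

primrec affine_iter :: "(nat \<Rightarrow> real) \<Rightarrow> (nat \<Rightarrow> real) \<Rightarrow> nat \<Rightarrow> real \<Rightarrow> real" where
  "affine_iter a b 0 t = t"
| "affine_iter a b (Suc i) t = a i * affine_iter a b i t + b i"

lemma affine_iter_affine:
  assumes "\<And>j. j < i \<Longrightarrow> \<bar>a j\<bar> \<le> 1"
  shows "\<exists>\<alpha> \<beta>. \<bar>\<alpha>\<bar> \<le> 1 \<and> (\<forall>t. affine_iter a b i t = \<alpha> * t + \<beta>)"
  using assms
proof (induction i)
  case 0
  show ?case by (intro exI[of _ 1] exI[of _ 0]) simp
next
  case (Suc i)
  then obtain \<alpha> \<beta> where \<alpha>: "\<bar>\<alpha>\<bar> \<le> 1" "\<And>t. affine_iter a b i t = \<alpha> * t + \<beta>" by fastforce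
  have "\<bar>a i * \<alpha>\<bar> \<le> 1" using \<alpha>(1) Suc.prems[of i] by (simp add: abs_mult mult_le_one)
  then show ?case
    by (intro exI[of _ "a i * \<alpha>"] exI[of _ "a i * \<beta> + b i"]) (simp add: \<alpha> algebra_simps)
qed

lemma affine_unit_interval:
  fixes a b t :: real
  assumes "0 \<le> b" "b \<le> 1" "0 \<le> a + b" "a + b \<le> 1" "0 \<le> t" "t \<le> 1"
  shows "0 \<le> a * t + b" "a * t + b \<le> 1"
proof -
  have eq: "a * t + b = (1 - t) * b + t * (a + b)" by (simp add: algebra_simps)
  show "0 \<le> a * t + b" unfolding eq using assms by simp
  have "(1 - t) * b + t * (a + b) \<le> (1 - t) * 1 + t * 1"
    using assms by (intro add_mono mult_left_mono) auto
  then show "a * t + b \<le> 1" unfolding eq by simp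
qed

text \<open>The pull-backs compose, once around the cycle, to an affine contraction of the unit interval;
  its fixed point is the value at \<^term>\<open>z\<close>.\<close>

lemma (in cyclic_map) affine_pullback:
  fixes a b :: "'a \<Rightarrow> real"
  assumes a: "\<And>y. y \<in> L \<Longrightarrow> \<bar>a y\<bar> \<le> 1"
    and ab: "\<And>y. y \<in> L \<Longrightarrow> 0 \<le> b y \<and> b y \<le> 1 \<and> 0 \<le> a y + b y \<and> a y + b y \<le> 1"
    and z: "z \<in> L" "\<bar>a z\<bar> < 1"
  shows "\<exists>X. \<forall>y\<in>L. X y = a y * X (f y) + b y \<and> 0 \<le> X y \<and> X y \<le> 1"
proof -
  define M where "M = card L"
  \<comment> \<open>\<open>w\<close> runs backwards through the cycle, from the predecessor of
    \<open>z\<close> to \<open>z\<close> itself. Hence \<open>F M\<close> pulls back once around and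
    applies last the branch at \<open>z\<close>, the one assumed to contract.\<close>
  define w where "w = (\<lambda>i. (f ^^ (M - 1 - i)) z)"
  have wL: "w i \<in> L" for i unfolding w_def by (rule funpow_closed[OF z(1)])
  define F where "F = affine_iter (a \<circ> w) (b \<circ> w)"
  have F_Suc: "F (Suc i) t = a (w i) * F i t + b (w i)" for i t by (simp add: F_def)
  have F_unit: "0 \<le> F i t \<and> F i t \<le> 1" if "0 \<le> t" "t \<le> 1" for i t
  proof (induction i)
    case (Suc i)
    then show ?case using affine_unit_interval[of "b (w i)" "a (w i)" "F i t"] ab[OF wL[of i]]
      unfolding F_Suc by blast
  qed (use that in \<open>simp add: F_def\<close>)
  have Mpos: "0 < M" using finite_carrier nonempty by (simp add: M_def card_gt_0_iff)
  then obtain M' where M': "M = Suc M'" using gr0_implies_Suc by blast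
  obtain \<alpha>' \<beta>' where \<alpha>': "\<bar>\<alpha>'\<bar> \<le> 1" "\<And>t. F M' t = \<alpha>' * t + \<beta>'"
    using affine_iter_affine[of M' "a \<circ> w" "b \<circ> w"] a[OF wL] unfolding F_def by auto
  have "w M' = z" by (simp add: w_def M')
  define \<alpha> \<beta> where "\<alpha> = a z * \<alpha>'" and "\<beta> = a z * \<beta>' + b z"
  have FM: "F M t = \<alpha> * t + \<beta>" for t
    unfolding M' F_Suc \<open>w M' = z\<close> \<alpha>' \<alpha>_def \<beta>_def by (simp add: algebra_simps)
  have "\<bar>\<alpha>\<bar> \<le> \<bar>a z\<bar> * 1" unfolding \<alpha>_def abs_mult using \<alpha>'(1) by (intro mult_left_mono) auto
  then have \<alpha>1: "\<bar>\<alpha>\<bar> < 1" using z(2) by simp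
  define t where "t = \<beta> / (1 - \<alpha>)"
  have "t * (1 - \<alpha>) = \<beta>" using \<alpha>1 by (simp add: t_def)
  then have fix_t: "F M t = t" unfolding FM by (simp add: algebra_simps)
  have bounds: "0 \<le> \<beta>" "\<beta> \<le> 1" "\<alpha> + \<beta> \<le> 1"
    using F_unit[of 0 M] F_unit[of 1 M] unfolding FM by auto
  have t0: "0 \<le> t" unfolding t_def using bounds \<alpha>1 by simp
  have t1: "t \<le> 1" unfolding t_def using bounds \<alpha>1 by (simp add: divide_le_eq)
  define ix where "ix = inv_into {..<M} (\<lambda>j. (f ^^ j) z)"
  have inj_ix: "inj_on (\<lambda>j. (f ^^ j) z) {..<M}"
    using funpow_inj[OF z(1)] unfolding M_def by (auto intro: inj_onI)
  \<comment> \<open>The label \<open>j\<close> steps after \<open>z\<close> is reached from the end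
    of the cycle by \<open>M - j\<close> pull-backs of the fixed point.\<close>
  define X where "X = (\<lambda>y. F (M - ix y) t)"
  have X_pow: "X ((f ^^ j) z) = F (M - j) t" if "j < M" for j
    unfolding X_def ix_def using inv_into_f_f[OF inj_ix] that by simp
  have "X y = a y * X (f y) + b y \<and> 0 \<le> X y \<and> X y \<le> 1" if "y \<in> L" for y
  proof -
    have "y \<in> (\<lambda>j. (f ^^ j) z) ` {..<M}" using funpow_image[OF z(1)] that unfolding M_def by simp
    then obtain j where j: "j < M" "y = (f ^^ j) z" by auto
    have "M - j = Suc (M - 1 - j)" "w (M - 1 - j) = y" using j unfolding w_def by auto
    then have Xy: "X y = a y * F (M - 1 - j) t + b y" using X_pow[OF j(1)] j(2) F_Suc by simp
    have "X (f y) = F (M - 1 - j) t"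
    proof (cases "Suc j < M")
      case True
      then show ?thesis using X_pow[OF True] j(2) by simp
    next
      case False
      then have Mj: "M = Suc j" using j by simp
      then have "f y = (f ^^ 0) z" using funpow_card[OF z(1)] j(2) unfolding M_def by simp
      then have "X (f y) = F M t" using X_pow[OF Mpos] by simp
      then show ?thesis using fix_t Mj by (simp add: F_def)
    qed
    moreover have "0 \<le> X y \<and> X y \<le> 1" unfolding X_def by (rule F_unit[OF t0 t1])
    ultimately show ?thesis using Xy by simp
  qed
  then show ?thesis by blast
qed

locale expected_data = rotation_pair n m k l for n m k l +
  fixes p q :: nat
  assumes p_pos: "0 < p" and p_less_q: "p < q" and coprime_p_q: "coprime p q"
begin

abbreviation "N \<equiv> Nexp p q"
abbreviation "L \<equiv> labels (map N [0..<n])"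
abbreviation "pm \<equiv> pexp p q"
abbreviation "pre \<equiv> k + n - m"

lemma n_pos: "0 < n" using m_small by simp

lemma L_iff: "(r, s) \<in> L \<longleftrightarrow> r < n \<and> s < N r" by (simp add: labels_map)

lemma pre: "pre < n" "pre \<noteq> 0" "(pre + m) mod n = k" "ps k = Suc (ps pre)"
  using prev_edge[of k] kl_less by auto

lemma ps_k_le_0: "ps k \<le> ps 0" using ps_0 ps_less[of k] kl_less by simp

lemma N_vals: "N 0 = Suc q" "N k = Suc q" "N l = Suc (q - p)" "N m = 1" "N pre = Suc (q - p)"
  using ps_k_le_0 ps_l_k ps_m ps_l_pos pre p_less_q by (auto simp: Nexp_def)

lemma Nexp_pos: "0 < N r" using p_less_q by (simp add: Nexp_def)

lemma pm_at_0: "s < p \<Longrightarrow> pm (0, s) = (k, q - p + s)" "pm (0, p) = (l, q - p)"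
  "p < s \<Longrightarrow> s < q \<Longrightarrow> pm (0, s) = (l, s - p)" "pm (0, q) = (m, 0)"
  using p_less_q by (auto simp: pexp_def Let_def)

lemma pm_pre: "pm (pre, q - p) = (k, q)" using pre by (simp add: pexp_def Let_def)

lemma pm_shift: "r \<noteq> 0 \<Longrightarrow> r \<noteq> pre \<or> s \<noteq> q - p \<Longrightarrow> pm (r, s) = ((r + m) mod n, s)"
  by (auto simp: pexp_def Let_def)

lemma cases_0:
  assumes "s < N 0"
  obtains "s < p" | "s = p" | "p < s" "s < q" | "s = q"
  using assms N_vals(1) by fastforce

lemma N_le_succ: "0 < r \<Longrightarrow> r < n \<Longrightarrow> N r \<le> N ((r + m) mod n)"
  using ps_step[of r] p_less_q by (auto simp: Nexp_def)

lemma pm_closed: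
  assumes "y \<in> L" shows "pm y \<in> L"
proof -
  obtain r s where y: "y = (r, s)" by (cases y)
  have rs: "r < n" "s < N r" using assms L_iff y by auto
  show ?thesis
  proof (cases "r = 0")
    case True
    then have "s < N 0" using rs by simp
    then show ?thesis unfolding y True
      by (cases rule: cases_0) (use N_vals kl_less p_less_q in \<open>auto simp: pm_at_0 L_iff\<close>)
  next
    case False
    show ?thesis
    proof (cases "r = pre \<and> s = q - p")
      case True
      then show ?thesis unfolding y using pm_pre N_vals kl_less L_iff by simp
    next
      case nf: False
      then have "pm (r, s) = ((r + m) mod n, s)" using pm_shift False by blast
      moreover have "s < N ((r + m) mod n)" using N_le_succ[of r] rs False by simp
      ultimately show ?thesis using succ_less L_iff y by simp
    qed
  qed
qed

section \<open>The prescribed permutation is a single cycle\<close>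

definition Orb where "Orb = {(pm ^^ j) (0, 0) | j. True}"

lemma Orb_closed: "y \<in> Orb \<Longrightarrow> pm y \<in> Orb"
  unfolding Orb_def by (smt (verit) funpow.simps(2) mem_Collect_eq o_apply)

lemma Orb_start: "(0, 0) \<in> Orb"
  unfolding Orb_def by (metis (mono_tags, lifting) funpow_0 mem_Collect_eq)

text \<open>Labels travel along the list unchanged, except that \<open>q - p\<close> becomes
  \<open>q\<close> when it enters \<open>k\<close>; the last assumption rules out that
  crossing.\<close>

lemma Orb_flow:
  assumes "(a, s) \<in> Orb" "a < n" "r < n" "ps a \<le> ps r" "s = q - p \<Longrightarrow> ps r < ps k \<or> ps k \<le> ps a"
  shows "(r, s) \<in> Orb"
proof -
  have "(E j, s) \<in> Orb" if "ps a \<le> j" "j \<le> ps r" for j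
    using that
  proof (induction j rule: dec_induct)
    case base
    then show ?case using E_ps assms by simp
  next
    case (step j)
    have j: "Suc j < n" using step ps_less[OF assms(3)] by simp
    then have "E j \<noteq> 0" using E_eq_0_iff[of j] by auto
    moreover have "E j \<noteq> pre \<or> s \<noteq> q - p"
    proof (rule ccontr)
      assume "\<not> (E j \<noteq> pre \<or> s \<noteq> q - p)"
      then have "ps pre = j" "s = q - p" using ps_E[of j] j by auto
      then show False using assms(5) pre step by linarith
    qed
    ultimately have "pm (E j, s) = (E (Suc j), s)" using pm_shift by (simp add: E_Suc)
    then show ?case using Orb_closed[of "(E j, s)"] step by simp
  qed
  then show ?thesis using E_ps assms by (metis order_refl)
qed

lemma Orb_pm: "(0, s) \<in> Orb \<Longrightarrow> pm (0, s) = y \<Longrightarrow> y \<in> Orb"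
  using Orb_closed by metis

text \<open>From \<open>(0, p)\<close> the orbit follows the last labels of S and T, jumping from
  \<open>q - p\<close> to \<open>q\<close> at \<open>k\<close>, and passes through
  \<open>(0, q)\<close> to the start \<open>(m, 0)\<close> of the list.\<close>

lemma Orb_top:
  assumes "(0, p) \<in> Orb"
  shows "(l, q - p) \<in> Orb" "(k, q) \<in> Orb" "(0, q) \<in> Orb" "(m, 0) \<in> Orb"
proof -
  show l: "(l, q - p) \<in> Orb" using Orb_pm[OF assms] pm_at_0 by blast
  have "(pre, q - p) \<in> Orb" using Orb_flow[OF l, of pre] pre kl_less ps_l_k by simp
  then show k: "(k, q) \<in> Orb" using Orb_closed pm_pre by metis
  show q: "(0, q) \<in> Orb" using Orb_flow[OF k, of 0] kl_less n_pos ps_k_le_0 by simp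
  show "(m, 0) \<in> Orb" using Orb_pm[OF q] pm_at_0 by blast
qed

text \<open>Subtracting \<open>p\<close> modulo \<open>q\<close> is written as adding
  \<open>q - p\<close>. The labels below \<open>p\<close> return via \<open>k\<close>, those above
  via \<open>l\<close>; from \<open>p\<close> the orbit makes the detour through
  \<open>(0, q)\<close>.\<close>

lemma Orb_rotate:
  assumes "s < q" "(0, s) \<in> Orb"
  shows "(0, (s + (q - p)) mod q) \<in> Orb"
proof -
  consider "s < p" | "s = p" | "p < s" by linarith
  then show ?thesis
  proof cases
    case 1
    have "(k, q - p + s) \<in> Orb" using Orb_pm[OF assms(2)] pm_at_0(1)[OF 1] by blast
    then have "(0, q - p + s) \<in> Orb"
      using Orb_flow[of k "q - p + s" 0] kl_less n_pos ps_k_le_0 by simp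
    moreover have "(s + (q - p)) mod q = q - p + s" using 1 p_less_q by simp
    ultimately show ?thesis by simp
  next
    case 2
    have "(m, 0) \<in> Orb" using Orb_top(4) assms(2) 2 by simp
    then have "(0, 0) \<in> Orb" using Orb_start by simp
    then show ?thesis using 2 p_less_q by simp
  next
    case 3
    have "(l, s - p) \<in> Orb" using Orb_pm[OF assms(2)] pm_at_0(3)[OF 3 assms(1)] by blast
    then have "(0, s - p) \<in> Orb"
      using Orb_flow[of l "s - p" 0] kl_less n_pos ps_k_le_0 ps_l_k assms(1) 3 p_less_q by simp
    moreover have "s + (q - p) = s - p + q" using 3 p_less_q by simp
    then have "(s + (q - p)) mod q = s - p" using assms(1) by (simp only: mod_add_self2 mod_less less_imp_diff_less)
    ultimately show ?thesis by simp
  qed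
qed

lemma Orb_0:
  assumes "s < q" shows "(0, s) \<in> Orb"
proof -
  have q0: "0 < q" using p_less_q by simp
  have iter: "(0, (t * (q - p)) mod q) \<in> Orb" for t
  proof (induction t)
    case (Suc t)
    have "(0, ((t * (q - p)) mod q + (q - p)) mod q) \<in> Orb" by (rule Orb_rotate) (use Suc q0 in auto)
    then show ?case by (simp add: mod_simps add.commute)
  qed (simp add: Orb_start)
  have "coprime (q - p) q"
    using coprime_p_q p_less_q by (simp add: coprime_iff_gcd_eq_1 gcd_diff2_nat)
  \<comment> \<open>\<open>x\<close> inverts \<open>q - p\<close> modulo \<open>q\<close>, so
    \<open>s * x\<close> rotations lead from 0 to \<open>s\<close>.\<close>
  then obtain x y where "(q - p) * x = q * y + 1"
    using bezout_nat[of "q - p" q] p_less_q by auto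
  then have "(s * x) * (q - p) = s * (q * y + 1)" by (metis mult.assoc mult.commute)
  then have "((s * x) * (q - p)) mod q = (s + q * (s * y)) mod q" by (simp add: algebra_simps)
  also have "\<dots> = s" using assms by simp
  finally show ?thesis using iter[of "s * x"] by simp
qed

text \<open>Each label is met downstream of its entry: 0 from \<open>(m, 0)\<close>, labels up to
  \<open>q - p\<close> on S and below \<open>q - p\<close> on T from \<open>l\<close>, the others on
  T from \<open>k\<close>.\<close>

lemma L_subset_Orb: "L \<subseteq> Orb"
proof
  fix y assume yL: "y \<in> L"
  obtain r s where y: "y = (r, s)" by (cases y)
  have rs: "r < n" "s < N r" using yL L_iff y by auto
  note top = Orb_top[OF Orb_0[OF p_less_q]]
  have zero: "(r, 0) \<in> Orb" using Orb_flow[OF top(4) _ rs(1)] kl_less ps_m p_less_q by simp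
  have l: "(l, s) \<in> Orb" if "0 < s" "s < q - p" for s
    using Orb_pm[OF Orb_0[of "s + p"]] pm_at_0(3)[of "s + p"] that by simp
  consider "ps r < ps l" | "ps l \<le> ps r" "ps r < ps k" | "ps k \<le> ps r" by linarith
  then have "(r, s) \<in> Orb"
  proof cases
    case 1
    then have "s = 0" using rs by (simp add: Nexp_def)
    then show ?thesis using zero by simp
  next
    case 2
    then have "s \<le> q - p" using rs p_less_q by (simp add: Nexp_def)
    then have "(l, s) \<in> Orb \<or> s = 0" using top(1) l by (metis gr0I le_neq_implies_less)
    then show ?thesis using Orb_flow[of l s r] zero kl_less rs 2 by auto
  next
    case 3
    then have "s \<le> q" using rs ps_l_k by (simp add: Nexp_def)
    then consider "s = 0" | "0 < s" "s < q - p" | "q - p \<le> s" "s < q" | "s = q" by linarith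
    then show ?thesis
    proof cases
      case 1
      then show ?thesis using zero by simp
    next
      case 2
      then show ?thesis using Orb_flow[OF l[OF 2] _ rs(1)] kl_less 3 ps_l_k by simp
    next
      case s: 3
      then have "s - (q - p) < p" by linarith
      then have "(k, s) \<in> Orb" using Orb_pm[OF Orb_0[of "s - (q - p)"]] pm_at_0(1) s p_less_q by simp
      then show ?thesis using Orb_flow[of k s r] kl_less rs 3 by simp
    next
      case 4
      then show ?thesis using Orb_flow[OF top(2), of r] kl_less rs 3 by simp
    qed
  qed
  then show "y \<in> Orb" using y by simp
qed

lemma pm_cyclic: "cyclic_map pm L"
proof -
  have L0: "(0, 0) \<in> L" using L_iff Nexp_pos n_pos by simp
  have pow_L: "(pm ^^ j) (0, 0) \<in> L" for j
    by (induction j) (auto simp: L0 pm_closed)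
  \<comment> \<open>\<open>(n - m, 0)\<close> is sent to \<open>(0, 0)\<close>; as it lies on the
    orbit of \<open>(0, 0)\<close>, that orbit is periodic.\<close>
  have nm: "n - m \<noteq> 0" "n - m < n" "(n - m + m) mod n = 0" using m_small m_gt_1 by auto
  then have "(n - m, 0) \<in> Orb" using L_subset_Orb L_iff Nexp_pos by blast
  then obtain j where j: "(pm ^^ j) (0, 0) = (n - m, 0)" unfolding Orb_def by force
  have "pm (n - m, 0) = (0, 0)" using pm_shift[of "n - m" 0] nm p_less_q by simp
  then have per: "(pm ^^ Suc j) (0, 0) = (0, 0)" using j by simp
  have "L = {(pm ^^ i) (0, 0) | i. i < Suc j}"
  proof (intro equalityI subsetI)
    fix y assume "y \<in> L"
    then obtain i where "y = (pm ^^ i) (0, 0)" using L_subset_Orb unfolding Orb_def by blast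
    then have "y = (pm ^^ (i mod Suc j)) (0, 0)" using funpow_mod_eq[OF per] by simp
    then show "y \<in> {(pm ^^ i) (0, 0) | i. i < Suc j}" by (metis (mono_tags, lifting) mem_Collect_eq mod_less_divisor zero_less_Suc)
  qed (use pow_L in auto)
  then show ?thesis by (rule periodic_orbit_cyclic_map[OF zero_less_Suc per])
qed

end

section \<open>Positions realising the prescribed permutation\<close>

context expected_data
begin

text \<open>The target edge \<open>r\<close> leaves the pieces \<open>2 * r - 1\<close> and
  \<open>2 * r\<close>; the odd one is chosen for \<open>p\<close> only, the single reversing
  label.\<close>

definition piece :: "nat \<Rightarrow> nat" where
  "piece s = (if s < p then 2 * k else if s = p then 2 * l - 1 else if s < q then 2 * l else 2 * m)"

lemma piece_simps: "s < p \<Longrightarrow> piece s = 2 * k" "piece p = 2 * l - 1"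
  "p < s \<Longrightarrow> s < q \<Longrightarrow> piece s = 2 * l" "piece q = 2 * m"
  using p_less_q by (auto simp: piece_def)

lemma odd_piece_iff: "odd (piece s) \<longleftrightarrow> s = p"
  using k_less_l by (auto simp: piece_def)

lemma piece_le: "piece s \<le> 2 * m"
  using k_less_l l_less_m by (auto simp: piece_def)

lemma pm_piece:
  assumes "s < N 0" shows "fst (pm (0, s)) = (piece s + 1) div 2"
  using assms by (cases rule: cases_0) (use k_less_l in \<open>auto simp: pm_at_0 piece_simps\<close>)

text \<open>\<open>p\<close> is alone in its piece, so labels that share a piece share an
  orientation-preserving one.\<close>

lemma piece_mono:
  assumes "s < t" "t < N 0"
  shows "piece s < piece t \<or> piece s = piece t \<and> s \<noteq> p \<and> snd (pm (0, s)) < snd (pm (0, t))"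
  using assms(2)
proof (cases rule: cases_0)
  case 1
  then show ?thesis using assms by (simp add: piece_simps pm_at_0)
next
  case 2
  moreover have "2 * k < 2 * l - 1" using k_less_l by linarith
  ultimately show ?thesis using assms by (simp add: piece_simps)
next
  case 3
  consider "s < p" | "s = p" | "p < s" by linarith
  then show ?thesis
    using 3 assms k_less_l by cases (auto simp: piece_simps pm_at_0)
next
  case 4
  have "s < N 0" using assms by simp
  then show ?thesis
    by (cases rule: cases_0) (use 4 assms k_less_l l_less_m in \<open>auto simp: piece_simps\<close>)
qed

lemma coords_exist:
  "\<exists>X. \<forall>r s. r < n \<and> s < N r \<longrightarrow> 0 \<le> X (r, s) \<and> X (r, s) \<le> 1 \<and> (0 < r \<longrightarrow> X (pm (r, s)) = X (r, s)) \<and>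
    (r = 0 \<longrightarrow> (2 * real m + 1) * X (0, s) =
      real (piece s) + (if even (piece s) then X (pm (0, s)) else 1 - X (pm (0, s))))"
proof -
  interpret cyclic_map pm L by (rule pm_cyclic)
  define c where "c = 2 * real m + 1"
  have c: "1 < c" using m_gt_1 by (simp add: c_def)
  \<comment> \<open>\<open>a\<close> and \<open>b\<close> describe the inverse branches: with
    \<open>y\<close> the position of the image, a point of piece j is at \<open>(j + y) / c\<close>
    for even j and at \<open>(j + 1 - y) / c\<close> for odd j. Away from \<open>e_0\<close>
    positions are copied.\<close>
  define a where "a y = (if fst y = 0 then (if even (piece (snd y)) then 1 / c else - 1 / c) else 1)" for y :: "nat \<times> nat"
  define b where "b y = (if fst y = 0 then
     (if even (piece (snd y)) then real (piece (snd y)) / c else (real (piece (snd y)) + 1) / c) else 0)" for y :: "nat \<times> nat"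
  have "\<exists>X. \<forall>y\<in>L. X y = a y * X (pm y) + b y \<and> 0 \<le> X y \<and> X y \<le> 1"
  proof (rule affine_pullback)
    fix y assume "y \<in> L"
    show "\<bar>a y\<bar> \<le> 1" using c by (simp add: a_def)
    have e: "real (piece (snd y)) + 1 \<le> c" using piece_le[of "snd y"] unfolding c_def by linarith
    show "0 \<le> b y \<and> b y \<le> 1 \<and> 0 \<le> a y + b y \<and> a y + b y \<le> 1"
      using e c by (auto simp: a_def b_def field_simps)
  next
    show "(0, 0) \<in> L" using L_iff Nexp_pos n_pos by simp
    show "\<bar>a (0, 0)\<bar> < 1" using c by (simp add: a_def)
  qed
  then obtain X where X: "\<And>y. y \<in> L \<Longrightarrow> X y = a y * X (pm y) + b y \<and> 0 \<le> X y \<and> X y \<le> 1" by blast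
  have "c * X (0, s) = real (piece s) + (if even (piece s) then X (pm (0, s)) else 1 - X (pm (0, s)))"
    if "s < N 0" for s
  proof -
    have "X (0, s) = a (0, s) * X (pm (0, s)) + b (0, s)" using X[of "(0, s)"] L_iff n_pos that by simp
    then show ?thesis using c by (auto simp: a_def b_def field_simps)
  qed
  moreover have "X (pm (r, s)) = X (r, s)" if "0 < r" "r < n" "s < N r" for r s
    using X[of "(r, s)"] L_iff that by (simp add: a_def b_def)
  moreover have "0 \<le> X (r, s) \<and> X (r, s) \<le> 1" if "r < n" "s < N r" for r s
    using X[of "(r, s)"] L_iff that by simp
  ultimately show ?thesis unfolding c_def[symmetric] by (intro exI[of _ X]) blast
qed

definition X :: "nat \<times> nat \<Rightarrow> real" where
  "X = (SOME X. \<forall>r s. r < n \<and> s < N r \<longrightarrow> 0 \<le> X (r, s) \<and> X (r, s) \<le> 1 \<and> (0 < r \<longrightarrow> X (pm (r, s)) = X (r, s)) \<and>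
    (r = 0 \<longrightarrow> (2 * real m + 1) * X (0, s) =
      real (piece s) + (if even (piece s) then X (pm (0, s)) else 1 - X (pm (0, s)))))"

lemma X_unit: "r < n \<Longrightarrow> s < N r \<Longrightarrow> 0 \<le> X (r, s) \<and> X (r, s) \<le> 1"
  and X_edge: "0 < r \<Longrightarrow> r < n \<Longrightarrow> s < N r \<Longrightarrow> X (pm (r, s)) = X (r, s)"
  and X_0: "s < N 0 \<Longrightarrow> (2 * real m + 1) * X (0, s) =
      real (piece s) + (if even (piece s) then X (pm (0, s)) else 1 - X (pm (0, s)))"
  using someI_ex[OF coords_exist] n_pos unfolding X_def[symmetric] by blast+

lemma pm_in: "r < n \<Longrightarrow> s < N r \<Longrightarrow> fst (pm (r, s)) < n \<and> snd (pm (r, s)) < N (fst (pm (r, s)))"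
  using pm_closed[of "(r, s)"] L_iff by (metis prod.collapse)

lemma X_unit_pm: "r < n \<Longrightarrow> s < N r \<Longrightarrow> 0 \<le> X (pm (r, s)) \<and> X (pm (r, s)) \<le> 1"
  using X_unit pm_in by (metis prod.collapse)

text \<open>Position 0 would propagate along the cycle, since on \<open>e_0\<close> it forces piece
  0 and hence image position 0. But \<open>(0, q)\<close> lies in the piece
  \<open>2 * m > 0\<close>.\<close>

lemma X_pos:
  assumes "r < n" "s < N r" shows "0 < X (r, s)"
proof (rule ccontr)
  interpret cyclic_map pm L by (rule pm_cyclic)
  assume "\<not> 0 < X (r, s)"
  then have zero: "X (r, s) = 0" using X_unit[OF assms] by simp
  have "{y \<in> L. X y = 0} = L"
  proof (rule invariant_subset)
    show "(r, s) \<in> {y \<in> L. X y = 0}" using zero L_iff assms by simp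
    fix y assume y: "y \<in> {y \<in> L. X y = 0}"
    obtain a b where ab: "y = (a, b)" by (cases y)
    have in_L: "a < n" "b < N a" "X (a, b) = 0" using y ab L_iff by auto
    have "X (pm (a, b)) = 0"
    proof (cases "a = 0")
      case True
      then have eq: "0 = real (piece b) + (if even (piece b) then X (pm (0, b)) else 1 - X (pm (0, b)))"
        using X_0[of b] in_L by simp
      have u: "0 \<le> X (pm (0, b))" "X (pm (0, b)) \<le> 1" using X_unit_pm[of 0 b] in_L True by auto
      have "even (piece b)"
      proof (rule ccontr)
        assume odd: "odd (piece b)"
        then have "1 \<le> piece b" by (cases "piece b") auto
        then show False using eq u odd by (simp split: if_splits)
      qed
      then show ?thesis using eq u True by simp
    qed (use X_edge[of a b] in_L in simp)
    then show "pm y \<in> {y \<in> L. X y = 0}" using y ab closed by simp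
  qed blast
  moreover have "(0, q) \<in> L" using L_iff N_vals n_pos by simp
  ultimately have "X (0, q) = 0" by blast
  then show False using X_0[of q] X_unit_pm[of 0 q] N_vals n_pos m_gt_1 by (simp add: piece_simps)
qed

text \<open>The mirror argument: position 1 on \<open>e_0\<close> forces the last piece and image
  position 1, but \<open>(0, 0)\<close> lies in the piece \<open>2 * k < 2 * m\<close>.\<close>

lemma X_less_1:
  assumes "r < n" "s < N r" shows "X (r, s) < 1"
proof (rule ccontr)
  interpret cyclic_map pm L by (rule pm_cyclic)
  assume "\<not> X (r, s) < 1"
  then have one: "X (r, s) = 1" using X_unit[OF assms] by simp
  have "{y \<in> L. X y = 1} = L"
  proof (rule invariant_subset)
    show "(r, s) \<in> {y \<in> L. X y = 1}" using one L_iff assms by simp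
    fix y assume y: "y \<in> {y \<in> L. X y = 1}"
    obtain a b where ab: "y = (a, b)" by (cases y)
    have in_L: "a < n" "b < N a" "X (a, b) = 1" using y ab L_iff by auto
    have "X (pm (a, b)) = 1"
    proof (cases "a = 0")
      case True
      then have eq: "2 * real m + 1 = real (piece b) + (if even (piece b) then X (pm (0, b)) else 1 - X (pm (0, b)))"
        using X_0[of b] in_L by simp
      have u: "0 \<le> X (pm (0, b))" "X (pm (0, b)) \<le> 1" using X_unit_pm[of 0 b] in_L True by auto
      have le: "real (piece b) \<le> 2 * real m" using piece_le[of b] by linarith
      have "even (piece b)"
      proof (rule ccontr)
        assume odd: "odd (piece b)"
        then have "piece b \<noteq> 2 * m" by auto
        then have "real (piece b) + 1 \<le> 2 * real m" using piece_le[of b] by linarith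
        then show False using eq u odd by (simp split: if_splits)
      qed
      then show ?thesis using eq u le True by simp
    qed (use X_edge[of a b] in_L in simp)
    then show "pm y \<in> {y \<in> L. X y = 1}" using y ab closed by simp
  qed blast
  moreover have "(0, 0) \<in> L" using L_iff N_vals n_pos by simp
  ultimately have "X (0, 0) = 1" by blast
  moreover have "real k + 1 \<le> real m" using kl_less by linarith
  ultimately show False using X_0[of 0] X_unit_pm[of 0 0] N_vals n_pos p_pos by (simp add: piece_simps)
qed

text \<open>A pair of labels in the wrong order would stay in the wrong order along its whole orbit, yet no
  label precedes \<open>(0, 0)\<close> on its edge.\<close>

lemma X_mono:
  assumes "r < n" "s < t" "t < N r"
  shows "X (r, s) < X (r, t)"
proof (rule ccontr)
  interpret cyclic_map pm L by (rule pm_cyclic)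
  let ?V = "{y \<in> L. \<exists>s<snd y. X y \<le> X (fst y, s)}"
  assume "\<not> X (r, s) < X (r, t)"
  then have start: "(r, t) \<in> ?V" using assms L_iff by auto
  have "?V = L"
  proof (rule invariant_subset[OF _ start])
    fix y assume y: "y \<in> ?V"
    obtain a v where yav: "y = (a, v)" by (cases y)
    then obtain u where u: "u < v" "X (a, v) \<le> X (a, u)" using y by auto
    have av: "a < n" "v < N a" using y yav L_iff by auto
    then have uN: "u < N a" using u by simp
    have "fst (pm (a, u)) = fst (pm (a, v)) \<and> snd (pm (a, u)) < snd (pm (a, v)) \<and> X (pm (a, v)) \<le> X (pm (a, u))"
    proof (cases "a = 0")
      case False
      have "X (pm (a, v)) \<le> X (pm (a, u))" using X_edge[of a u] X_edge[of a v] False av uN u by simp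
      moreover have "fst (pm (a, u)) = fst (pm (a, v)) \<and> snd (pm (a, u)) < snd (pm (a, v))"
      \<comment> \<open>The only label shifted here, \<open>q - p\<close> on \<open>pre\<close>, is
        the last one and moves up, so order is preserved.\<close>
      proof (cases "a = pre")
        case True
        then have "v \<le> q - p" using av N_vals by simp
        then show ?thesis
          using pm_shift[of a u] pm_shift[of a v] pm_pre pre u True False p_less_q
          by (cases "v = q - p") auto
      next
        case ne: False
        then show ?thesis using pm_shift[of a u] pm_shift[of a v] False u by simp
      qed
      ultimately show ?thesis by blast
    next
      case True
      have uv0: "u < N 0" "v < N 0" using uN av True by auto
      have ul: "X (pm (0, u)) < 1 \<and> 0 < X (pm (0, u))" "X (pm (0, v)) < 1 \<and> 0 < X (pm (0, v))"
        using X_pos X_less_1 pm_in[OF n_pos uv0(1)] pm_in[OF n_pos uv0(2)] by (metis prod.collapse)+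
      have le: "(2 * real m + 1) * X (0, v) \<le> (2 * real m + 1) * X (0, u)"
        using u True by (intro mult_left_mono) auto
      \<comment> \<open>Points with interior image positions in different pieces are ordered as the
        pieces. An inversion therefore lives in one common even piece, whose increasing branch hands
        it on to the images.\<close>
      have "\<not> piece u < piece v"
      proof
        assume "piece u < piece v"
        then have "real (piece u) + 1 \<le> real (piece v)" by linarith
        then show False using le X_0[OF uv0(1)] X_0[OF uv0(2)] ul by (auto split: if_splits)
      qed
      then have eq: "piece u = piece v" "u \<noteq> p" "snd (pm (0, u)) < snd (pm (0, v))"
        using piece_mono[OF u(1) uv0(2)] by auto
      have "even (piece u)" using odd_piece_iff[of u] eq(2) by simp
      then have ev: "even (piece u)" "even (piece v)" using eq(1) by simp_all
      have "X (pm (0, v)) \<le> X (pm (0, u))" using le X_0[OF uv0(1)] X_0[OF uv0(2)] eq(1) ev by simp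
      then show ?thesis using True eq pm_piece[OF uv0(1)] pm_piece[OF uv0(2)] by simp
    qed
    moreover then have "X (pm (a, u)) = X (fst (pm (a, v)), snd (pm (a, u)))" by (metis prod.collapse)
    ultimately have "X (pm y) \<le> X (fst (pm y), snd (pm (a, u))) \<and> snd (pm (a, u)) < snd (pm y)"
      unfolding yav by simp
    then show "pm y \<in> ?V" using closed y by blast
  qed blast
  moreover have "(0, 0) \<in> L" using L_iff Nexp_pos n_pos by simp
  ultimately have "(0, 0) \<in> ?V" by simp
  then show False by simp
qed

definition x :: "nat \<Rightarrow> nat \<Rightarrow> real" where "x r s = X (r, s)"

definition P :: "spt set" where "P = {Ed r (x r s) | r s. r < n \<and> s < N r}"

lemma x_eq_X: "x (fst y) (snd y) = X y" by (simp add: x_def)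

sublocale star_coords n m x N P pm piece
proof
  show "fst (pm (r, s)) = (r + m) mod n" if "0 < r" "r < n" "s < N r" for r s
    using that pm_shift[of r s] pm_pre pre by (cases "r = pre \<and> s = q - p") auto
  show "(2 * real m + 1) * x 0 s = real (piece s) +
      (if even (piece s) then x (fst (pm (0, s))) (snd (pm (0, s)))
       else 1 - x (fst (pm (0, s))) (snd (pm (0, s))))" if "s < N 0" for s
    unfolding x_eq_X unfolding x_def by (rule X_0[OF that])
qed (simp_all add: Nexp_pos X_mono X_pos X_less_1 pm_in X_edge pm_piece P_def x_def)

lemma pm_min: "0 < r \<Longrightarrow> pm (r, 0) = ((r + m) mod n, 0)"
  using pm_shift[of r 0] p_less_q by simp

lemma star_orbit_P: "star_orbit n m P"
proof -
  interpret cyclic_map pm L by (rule pm_cyclic)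
  let ?pt = "\<lambda>y. Ed (fst y) (x (fst y) (snd y))"
  have L0: "(0, 0) \<in> L" using L_iff Nexp_pos n_pos by simp
  have P_L: "P = ?pt ` L" unfolding P_def labels_map by force
  have pow: "(fstar n m ^^ j) (?pt (0, 0)) = ?pt ((pm ^^ j) (0, 0))" for j
  proof (induction j)
    case (Suc j)
    let ?z = "(pm ^^ j) (0, 0)"
    have "(fst ?z, snd ?z) \<in> L" using funpow_closed[OF L0] by simp
    then have "fst ?z < n" "snd ?z < N (fst ?z)" unfolding L_iff by auto
    then show ?case using fstar_coords[of "fst ?z" "snd ?z"] Suc by simp
  qed simp
  have "valid_pt n (?pt (0, 0))" using x_pos[of 0 0] x_less_1[of 0 0] Nexp_pos n_pos by (simp add: valid_pt_def less_imp_le)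
  moreover have "0 < card L" using L0 finite_carrier card_gt_0_iff by blast
  moreover have "(fstar n m ^^ card L) (?pt (0, 0)) = ?pt (0, 0)"
    unfolding pow funpow_card[OF L0] by simp
  moreover have "P = {(fstar n m ^^ j) (?pt (0, 0)) | j. j < card L}"
  proof -
    have "P = ?pt ` (\<lambda>j. (pm ^^ j) (0, 0)) ` {..<card L}" unfolding funpow_image[OF L0] by (rule P_L)
    also have "\<dots> = (\<lambda>j. (fstar n m ^^ j) (?pt (0, 0))) ` {..<card L}" unfolding pow image_image ..
    finally show ?thesis by auto
  qed
  ultimately have per: "\<exists>x k. valid_pt n x \<and> 0 < k \<and> (fstar n m ^^ k) x = x \<and>
            P = {(fstar n m ^^ j) x | j. j < k}" by blast
  have e0: "Ed 0 (x 0 0) \<in> P" unfolding P_def using Nexp_pos n_pos by blast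
  have "fstar n m (Ed 0 (x 0 0)) = Ed k (x k (q - p))"
    using fstar_coords[of 0 0] Nexp_pos n_pos pm_at_0(1)[OF p_pos] by simp
  then have "fstar n m (Ed 0 (x 0 0)) \<notin> {y. on_edge m y}" using kl_less by (simp add: on_edge_def)
  moreover have "Ed 0 (x 0 0) \<in> {y \<in> P. on_edge 0 y}" using e0 by (simp add: on_edge_def)
  ultimately have "\<not> (fstar n m ` {y\<in>P. on_edge 0 y} \<subseteq> {y. on_edge m y})" by blast
  moreover have "P \<noteq> {Ctr}" using e0 by auto
  moreover have "edge_pts P r \<noteq> {}" if "r < n" for r using edge_pts_eq[OF that] Nexp_pos by auto
  moreover have "fstar n m (ptlab P r 0) = ptlab P ((r + m) mod n) 0" if "0 < r" "r < n" for r
    using that fstar_coords[of r 0] pm_min[of r] Nexp_pos succ_less by (simp add: ptlab_eq)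
  ultimately show ?thesis unfolding star_orbit_def using per by blast
qed

section \<open>Data and colours of the realised orbit\<close>

lemma snd_pm_0_pos: "s < q \<Longrightarrow> 0 < snd (pm (0, s))"
  using p_less_q pm_at_0 by (cases s p rule: linorder_cases) auto

lemma odata_P: "odata n m P = Dpq p q"
proof -
  have less_q: "loc_rev n m P (labpar P 0 s) \<longleftrightarrow> s = p" "loc_pres n m P (labpar P 0 s) \<longleftrightarrow> s \<noteq> p"
    "\<not> loc_noninj n m P (labpar P 0 s)" if "s < q" for s
    using local_type_inner[of s] snd_pm_0_pos[OF that] odd_piece_iff that N_vals(1) by auto
  have at_q: "\<not> loc_rev n m P (labpar P 0 q)" "\<not> loc_pres n m P (labpar P 0 q)"
    "loc_noninj n m P (labpar P 0 q)"
    using local_type_min[of q] p_less_q N_vals(1) pm_at_0(4) by auto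
  have s: "s < Ncnt P 0 \<longleftrightarrow> s < q \<or> s = q" for s using Ncnt_eq[OF n_pos] N_vals(1) by auto
  have "{s. s < Ncnt P 0 \<and> loc_rev n m P (labpar P 0 s)} = {p}"
    unfolding s using less_q at_q p_less_q by blast
  moreover have "{s. s < Ncnt P 0 \<and> loc_pres n m P (labpar P 0 s)} = {0..<q} - {p}"
    unfolding s using less_q at_q by auto
  moreover have "{s. s < Ncnt P 0 \<and> loc_noninj n m P (labpar P 0 s)} = {q}"
    unfolding s using less_q at_q by blast
  ultimately show ?thesis unfolding odata_def Dpq_def Nlist_eq piP_eq by simp
qed

text \<open>The explicit colouring: \<beta> holds the last label of each edge of S and T. An edge of
  R has only the label 0, which differs from \<open>q - p\<close>.\<close>

definition colour :: "nat \<times> nat \<Rightarrow> bool" where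
  "colour y = (snd y = (if ps (fst y) < ps k then q - p else q))"

lemma Dpq_in_TTset: "Dpq p q \<in> TTset n m k GB"
proof -
  define pm' where "pm' = (\<lambda>y. if y \<in> L then pm y else undefined)"
  have pm'_eq: "pm' y = pm y" if "y \<in> L" for y using that by (simp add: pm'_def)
  have piP: "piP n m P = pm'" unfolding piP_eq pm'_def ..
  have Ncnt: "map (Ncnt P) [0..<n] = map N [0..<n]" using Ncnt_eq by simp
  have cyc: "cyclic_map pm' L" using star_orbit_piP_cyclic[OF star_orbit_P] unfolding piP Ncnt .
  interpret coloured_orbit pm' "map N [0..<n]" m n "{p}" "{0..<q} - {p}" "{q}"
    using star_orbit_piP_min[OF star_orbit_P] unfolding piP
    by (intro coloured_orbitI cyc Nexp_pos) auto
  have D: "Dpq p q = D" by (simp add: Dpq_def pm'_def)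
  have col_k: "colour (k, s) \<longleftrightarrow> s = q" and col_l: "colour (l, s) \<longleftrightarrow> s = q - p"
    and col_0: "colour (0, s) \<longleftrightarrow> s = q" for s
    using ps_l_k ps_k_le_0 by (auto simp: colour_def)
  have law: "colour_law colour"
    unfolding colour_law_def
  proof (intro ballI impI)
    fix y assume yL: "y \<in> L" and pos: "0 < snd y"
    obtain r s where y: "y = (r, s)" by (cases y)
    have rs: "r < n" "s < N r" "0 < s" using yL L_iff y pos by auto
    show "if pm' y = (m, 0) then colour y
      else colour y = (colour (pm' y) \<noteq> (fst y = 0 \<and> snd y \<in> {p}))"
      unfolding pm'_eq[OF yL] unfolding y
    proof (cases "r = 0")
      case True
      then have "s < N 0" using rs by simp
      then show "if pm (r, s) = (m, 0) then colour (r, s)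
        else colour (r, s) = (colour (pm (r, s)) \<noteq> (fst (r, s) = 0 \<and> snd (r, s) \<in> {p}))"
        unfolding True
        by (cases rule: cases_0) (use p_less_q p_pos rs in \<open>auto simp: pm_at_0 col_k col_l col_0\<close>)
    next
      case False
      have "colour (r, s) = colour (pm (r, s))"
      proof (cases "r = pre")
        case True
        have "colour (r, s) \<longleftrightarrow> s = q - p" using True pre by (simp add: colour_def)
        moreover have "s \<le> q - p" using rs True N_vals by simp
        ultimately show ?thesis using True pm_pre pm_shift[of r s] pre p_pos p_less_q col_k False
          by (cases "s = q - p") auto
      next
        case ne: False
        have "ps ((r + m) mod n) = Suc (ps r)" using ps_step False rs by simp
        \<comment> \<open>Only the step from \<open>pre\<close> to \<open>k\<close> crosses the
          position where the last label changes from \<open>q - p\<close> to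
          \<open>q\<close>.\<close>
        moreover have "ps ((r + m) mod n) \<noteq> ps k"
          using E_ps[OF succ_less[of r]] E_ps[of k] kl_less succ_eq_iff[OF rs(1), of k] ne by auto
        ultimately have "ps ((r + m) mod n) < ps k \<longleftrightarrow> ps r < ps k" by auto
        then show ?thesis using pm_shift[of r s] False ne by (simp add: colour_def)
      qed
      moreover have "fst (pm (r, s)) = (r + m) mod n" using pm_edge[of r s] rs False by simp
      then have "pm (r, s) \<noteq> (m, 0)" using succ_eq_m_iff[OF rs(1)] False by auto
      ultimately show "if pm (r, s) = (m, 0) then colour (r, s)
        else colour (r, s) = (colour (pm (r, s)) \<noteq> (fst (r, s) = 0 \<and> snd (r, s) \<in> {p}))"
        using False by simp
    qed
  qed
  note sets = colour_sets[OF law]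
  have L0: "(0, s) \<in> L" if "s \<le> q" for s using L_iff n_pos N_vals(1) that by simp
  have a: "(s \<in> {0..<q} - {p} \<longrightarrow> pm' (0, s) \<in> alphaS n m D) \<and> (s \<in> {p} \<longrightarrow> pm' (0, s) \<in> betaS n m D)"
    if "s < q" for s
  proof -
    have L: "pm' (0, s) \<in> L" "0 < snd (pm' (0, s))"
      using closed[OF L0] snd_pm_0_pos[OF that] pm'_eq[OF L0] that by auto
    have "colour (pm' (0, s)) \<longleftrightarrow> s = p"
      using pm'_eq[OF L0, of s] that p_less_q p_pos
      by (cases s p rule: linorder_cases) (auto simp: pm_at_0 col_k col_l)
    then show ?thesis unfolding sets using L by auto
  qed
  have b: "map N [0..<n] ! (r + n - m) = 1" if "k < r" "r < m" for r
  proof -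
    have "ps r \<le> ps l" using ps_between[of r] that by (cases "r = l") auto
    then show ?thesis using prev_edge[OF that(2)] by (simp add: Nexp_def)
  qed
  have c: "pm' (pre, s) \<in> betaS n m D"
    if "0 < s" "s < N pre" "snd (pm' (pre, s)) > snd (pm' (0, 0))" for s
  proof -
    have sL: "(pre, s) \<in> L" using L_iff pre that by simp
    have "snd (pm' (0, 0)) = q - p" using pm'_eq[OF L0[of 0]] pm_at_0(1)[OF p_pos] by simp
    \<comment> \<open>A smaller \<open>s\<close> keeps its value and stays below the first newcomer,
      which sits at \<open>q - p\<close>. Only the last label jumps above it, to
      \<open>(k, q)\<close>, which is in \<beta>.\<close>
    then have "s = q - p"
      using that pm'_eq[OF sL] pm_shift[of pre s] pre N_vals by fastforce
    then have "pm' (pre, s) = (k, q)" using pm'_eq[OF sL] pm_pre by simp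
    then show ?thesis unfolding sets using closed[OF sL] p_less_q col_k by auto
  qed
  have "TTcond n m k GB D"
    unfolding TTcond_def using a b c N_vals(1) n_pos pre(1) by auto
  moreover have "Pcond k GB D"
    unfolding Pcond_def using pm'_eq[OF L0[of 0]] pm_at_0(1)[OF p_pos] p_pos p_less_q by simp
  ultimately show ?thesis
    unfolding TTset_def using odata_P star_orbit_P D by (metis (mono_tags, lifting) mem_Collect_eq)
qed

end

section \<open>The bijection with the rationals in the unit interval\<close>

lemma (in rotation_pair) Dpq_inj: "Dpq p q = Dpq p' q' \<Longrightarrow> p = p' \<and> q = q'"
  by (simp add: Dpq_def)

lemma (in rotation) Dexp_eq_Dpq:
  assumes "1 \<le> i" "i < card (Aset n m)"
  shows "Dexp n m i x = rotation_pair.Dpq n m (kth n m i) (kth n m (i + 1))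
    (nat (fst (quotient_of x))) (nat (snd (quotient_of x)))"
proof -
  interpret rotation_pair n m "kth n m i" "kth n m (i + 1)"
    by (rule rotation_pair_kth[OF assms])
  have N: "map (\<lambda>r. if r \<in> Rseg n m i then 1 else if r \<in> Sseg n m i then q + 1 - p
                      else if r \<in> Tseg n m i then q + 1 else 0) [0..<n] = map (Nexp p q) [0..<n]" for p q
  proof (rule map_cong[OF refl])
    fix r assume "r \<in> set [0..<n]"
    then have r: "r < n" by simp
    show "(if r \<in> Rseg n m i then 1 else if r \<in> Sseg n m i then q + 1 - p
        else if r \<in> Tseg n m i then q + 1 else 0) = Nexp p q r"
      unfolding Rseg_def Sseg_def Tseg_def oseg_R[OF r] oseg_S[OF r] oseg_T[OF r] Nexp_def by auto
  qed
  show ?thesis unfolding Dexp_def Dpq_def Let_def pexp_def N ..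
qed

theorem theorem2p22:
  fixes m n i :: nat
  assumes "coprime m n" and "1 < m" and "2 * m < n"
      and "1 \<le> i" and "i < card (Aset n m)"
  shows "bij_betw (Dexp n m i) {x :: rat. 0 < x \<and> x < 1} (TTset n m (kth n m i) GB)"
proof -
  interpret rotation n m by unfold_locales (fact assms)+
  interpret rotation_pair n m "kth n m i" "kth n m (i + 1)"
    by (rule rotation_pair_kth[OF assms(4,5)])
  have Dexp: "Dexp n m i x = Dpq (nat a) (nat b)" if "quotient_of x = (a, b)" for x a b
    using Dexp_eq_Dpq[OF assms(4,5), of x] that by simp
  have unit: "\<exists>p q. quotient_of x = (int p, int q) \<and> 0 < p \<and> p < q \<and> coprime p q"
    if "0 < x" "x < 1" for x
  proof -
    obtain a b where ab: "quotient_of x = (a, b)" by (cases "quotient_of x")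
    have b: "0 < b" and cop: "coprime a b" and x: "x = of_int a / of_int b"
      using quotient_of_denom_pos[OF ab] quotient_of_coprime[OF ab] quotient_of_div[OF ab] by auto
    have "0 < a" using that(1) b x by (simp add: zero_less_divide_iff)
    moreover have "a < b" using that(2) b x by simp
    ultimately show ?thesis
      using ab cop b by (intro exI[of _ "nat a"] exI[of _ "nat b"]) (auto simp: coprime_int_iff[symmetric])
  qed
  have "inj_on (Dexp n m i) {x. 0 < x \<and> x < 1}"
  proof (rule inj_onI)
    fix x y :: rat assume xy: "x \<in> {x. 0 < x \<and> x < 1}" "y \<in> {x. 0 < x \<and> x < 1}"
      and eq: "Dexp n m i x = Dexp n m i y"
    obtain p q where x: "quotient_of x = (int p, int q)" using unit xy by blast
    obtain p' q' where y: "quotient_of y = (int p', int q')" using unit xy by blast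
    have "p = p' \<and> q = q'" using eq Dpq_inj unfolding Dexp[OF x] Dexp[OF y] by simp
    then show "x = y" using x y by (simp add: quotient_of_inject)
  qed
  moreover have "Dexp n m i ` {x. 0 < x \<and> x < 1} = TTset n m (kth n m i) GB"
  proof (intro equalityI subsetI)
    fix D assume "D \<in> Dexp n m i ` {x. 0 < x \<and> x < 1}"
    then obtain x where x: "0 < x" "x < 1" "D = Dexp n m i x" by auto
    obtain p q where pq: "quotient_of x = (int p, int q)" "0 < p" "p < q" "coprime p q"
      using unit x by blast
    interpret expected_data n m "kth n m i" "kth n m (i + 1)" p q by unfold_locales (fact pq)+
    show "D \<in> TTset n m (kth n m i) GB" using Dpq_in_TTset Dexp[OF pq(1)] x(3) by simp
  next
    fix D assume "D \<in> TTset n m (kth n m i) GB"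
    then obtain p q where pq: "0 < p" "p < q" "coprime p q" "D = Dpq p q"
      using TTset_imp_Dpq by blast
    let ?x = "Fract (int p) (int q)"
    have "quotient_of ?x = (int p, int q)"
      using pq by (simp add: quotient_of_Fract normalize_stable coprime_int_iff)
    then have "D = Dexp n m i ?x" using Dexp[of ?x] pq(4) by simp
    moreover have "0 < ?x" "?x < 1" using pq by (simp_all add: zero_less_Fract_iff Fract_less_one_iff)
    ultimately show "D \<in> Dexp n m i ` {x. 0 < x \<and> x < 1}" by blast
  qed
  ultimately show ?thesis unfolding bij_betw_def by blast
qed

end
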